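(* Let $f$ be a cookie-cutter mapping with $N\ge 2$ branches, let $E$ be the associated cookie-cutter set, let $\mu_h$ be the Gibbs-like measure supported by $E$, and let $\beta$ be the temperature function of $\mu_h$. Then for each $r\in(0,+\infty)$ there exists a unique $\kappa_r\in(0,+\infty)$ such that, writing $q_r:=\frac{\kappa_r}{r+\kappa_r}$, $$\kappa_r=\frac{\beta(q_r)}{1-q_r},\qquad\text{i.e.}\qquad \beta(q_r)=r\,q_r ,$$ and this $\kappa_r$ is the quantization dimension of order $r$ of $\mu_h$: the limit $D_r(\mu_h)=\lim_{n\to\infty}\frac{r\log n}{-\log V_{n,r}(\mu_h)}$ exists and equals $\kappa_r$. Moreover, the $\kappa_r$-dimensional lower quantization coefficient is positive, i.e. $$\liminf_{n\to\infty} n\,V_{n,r}(\mu_h)^{\kappa_r/r}>0 .$$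
   Context: Cookie-cutter. Let $J=[0,1]$. A mapping $f$ is a cookie-cutter mapping if there are finitely many disjoint closed intervals $J_1,\dots,J_N\subset J$ such that: (C1) $f$ is defined in a neighborhood of each $J_j$, and the restriction $f|_{J_j}$ maps $J_j$ bijectively onto $J$; the branch inverse is $\varphi_j:=(f|_{J_j})^{-1}:J\to J_j$; (C2) $f$ is differentiable and there are $c>0$, $\gamma\in(0,1]$ with $|f'(x)-f'(y)|\le c|x-y|^\gamma$ for $x,y\in J_j$, $1\le j\le N$; (C3) $1<b:=\inf_x|f'(x)|\le\sup_x|f'(x)|=:B<+\infty$. Here $N\ge2$. Words. $\Omega_n=\{1,\dots,N\}^n$ for $n\ge1$, $\Omega_0$ consists of the empty word, $\Omega=\bigcup_{k\ge0}\Omega_k$, $\Omega_\infty=\{1,\dots,N\}^{\mathbb N}$; $|\sigma|$ is the length of $\sigma\in\Omega$, and $\sigma\tau$ is concatenation. For $\sigma=(\sigma_1,\dots,\sigma_n)$, $\varphi_\sigma=\varphi_{\sigma_1}\circ\cdots\circ\varphi_{\sigma_n}$ (identity on $J$ for the empty word), $J_\sigma=\varphi_\sigma(J)$, $|J_\sigma|$ is the diameter of $J_\sigma$, $\|\varphi_\sigma'\|=\sup_{x\in J}|\varphi_\sigma'(x)|$, and $C(\sigma)=\{\tau\in\Omega_\infty:\tau|_{|\sigma|}=\sigma\}$, where $\tau|_k$ is the truncation of $\tau$ to its first $k$ letters. The coding map $\pi:\Omega_\infty\to J$ sends $\sigma$ to the unique point of $\bigcap_{k\ge0}J_{\sigma|_k}$,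 and $E:=\pi(\Omega_\infty)$ is the cookie-cutter set. Gibbs-like measure. For $t\in\mathbb R$ the limit $Q(t)=\lim_{k\to\infty}\frac1k\log\sum_{\sigma\in\Omega_k}\|\varphi_\sigma'\|^t$ exists, and $h\in(0,+\infty)$ denotes the unique number with $Q(h)=0$. A Banach limit is a linear functional $\mathrm{Lim}$ on bounded real sequences that is invariant under $(x_n)\mapsto(x_{n+1})$ and lies between $\liminf x_n$ and $\limsup x_n$; fix one. For $\sigma\in\Omega$ and $n\ge1$ put $$\nu_n(C(\sigma))=\frac{\sum_{\tau\in\Omega_n}|J_{\sigma\tau}|^h}{\sum_{\tau\in\Omega_{|\sigma|+n}}|J_\tau|^h}.$$ Let $\gamma_0$ be the unique Borel probability measure on $\Omega_\infty$ with $\gamma_0(C(\sigma))=\mathrm{Lim}_{n\to\infty}\nu_n(C(\sigma))$ for all $\sigma\in\Omega$. The Gibbs-like measure is $\mu_h:=\gamma_0\circ\pi^{-1}$, a Borel probability measure supported by $E$. Temperature function. For $q,t\in\mathbb R$ the limit $P(q,t)=\lim_{k\to\infty}\frac1k\log\sum_{\sigma\in\Omega_k}(\mu_h(J_\sigma))^q\|\varphi_\sigma'\|^t$ exists, and for each $q$ there is a unique $\beta(q)\in\mathbb R$ with $P(q,\beta(q))=0$; $\beta$ is the temperature function. Quantization. For a Borel probability measure $\mu$ on $\mathbb R$, $V_{n,r}(\mu)=\inf\{\int d(x,\alpha)^r\,d\mu(x):\emptyset\ne\alpha\subset\mathbb R,\ \mathrm{card}(\alpha)\le n\}$, where $d(x,\alpha)$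 is the distance from $x$ to $\alpha$ with respect to a given norm on $\mathbb R$. The quantization dimension of order $r$ of $\mu$ is $D_r(\mu)=\lim_{n\to\infty}\frac{r\log n}{-\log V_{n,r}(\mu)}$ when this limit exists. *)

theory Defs
  imports "HOL-Probability.Probability"
begin

text \<open>
  The partially defined map is modelled by a total function whose values away from a
  neighbourhood of the branch intervals \<open>J 1, \<dots>, J N\<close> are irrelevant.  The infimum and the
  supremum of the absolute value of the derivative are those over the union of the \<open>J j\<close>.
\<close>

definition cookie_cutter :: "(real \<Rightarrow> real) \<Rightarrow> (nat \<Rightarrow> real set) \<Rightarrow> nat \<Rightarrow> bool" where
  "cookie_cutter f J N \<longleftrightarrow>
     2 \<le> N \<and>
     (\<forall>j\<in>{1..N}. (\<exists>a b. J j = {a..b}) \<and> J j \<subseteq> {0..1}) \<and>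
     disjoint_family_on J {1..N} \<and>
     (\<forall>j\<in>{1..N}. bij_betw f (J j) {0..1}) \<and>
     (\<exists>U. open U \<and> (\<Union>j\<in>{1..N}. J j) \<subseteq> U \<and> f differentiable_on U) \<and>
     (\<exists>c>0. \<exists>\<gamma>. 0 < \<gamma> \<and> \<gamma> \<le> 1 \<and>
        (\<forall>j\<in>{1..N}. \<forall>x\<in>J j. \<forall>y\<in>J j. \<bar>deriv f x - deriv f y\<bar> \<le> c * \<bar>x - y\<bar> powr \<gamma>)) \<and>
     1 < (INF x\<in>(\<Union>j\<in>{1..N}. J j). \<bar>deriv f x\<bar>) \<and>
     bdd_above ((\<lambda>x. \<bar>deriv f x\<bar>) ` (\<Union>j\<in>{1..N}. J j))"

definition words :: "nat \<Rightarrow> nat \<Rightarrow> nat list set" where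
  "words N n = {\<sigma>. length \<sigma> = n \<and> set \<sigma> \<subseteq> {1..N}}"

definition inf_words :: "nat \<Rightarrow> (nat \<Rightarrow> nat) set" where
  "inf_words N = {\<tau>. \<forall>i. \<tau> i \<in> {1..N}}"

definition trunc :: "nat \<Rightarrow> (nat \<Rightarrow> nat) \<Rightarrow> nat list" where
  "trunc k \<tau> = map \<tau> [0..<k]"

definition cylinder :: "nat \<Rightarrow> nat list \<Rightarrow> (nat \<Rightarrow> nat) set" where
  "cylinder N \<sigma> = {\<tau>\<in>inf_words N. trunc (length \<sigma>) \<tau> = \<sigma>}"

text \<open>
  The maps below are meaningful on \<open>{0..1}\<close> only: the branch inverses \<^const>\<open>inv_into\<close> are
  arbitrary outside.  This is why derivatives of \<open>word_map f J \<sigma>\<close> are taken within \<open>{0..1}\<close>.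
\<close>

primrec word_map :: "(real \<Rightarrow> real) \<Rightarrow> (nat \<Rightarrow> real set) \<Rightarrow> nat list \<Rightarrow> real \<Rightarrow> real" where
  "word_map f J [] = id"
| "word_map f J (j # \<sigma>) = inv_into (J j) f \<circ> word_map f J \<sigma>"

definition word_interval :: "(real \<Rightarrow> real) \<Rightarrow> (nat \<Rightarrow> real set) \<Rightarrow> nat list \<Rightarrow> real set" where
  "word_interval f J \<sigma> = word_map f J \<sigma> ` {0..1}"

definition word_deriv_norm :: "(real \<Rightarrow> real) \<Rightarrow> (nat \<Rightarrow> real set) \<Rightarrow> nat list \<Rightarrow> real" where
  "word_deriv_norm f J \<sigma> =
     (SUP x\<in>{0..1}. \<bar>vector_derivative (word_map f J \<sigma>) (at x within {0..1})\<bar>)"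

definition coding :: "(real \<Rightarrow> real) \<Rightarrow> (nat \<Rightarrow> real set) \<Rightarrow> (nat \<Rightarrow> nat) \<Rightarrow> real" where
  "coding f J \<tau> = (THE x. x \<in> (\<Inter>k. word_interval f J (trunc k \<tau>)))"

definition cookie_cutter_set :: "(real \<Rightarrow> real) \<Rightarrow> (nat \<Rightarrow> real set) \<Rightarrow> nat \<Rightarrow> real set" where
  "cookie_cutter_set f J N = coding f J ` inf_words N"

definition cc_pressure :: "(real \<Rightarrow> real) \<Rightarrow> (nat \<Rightarrow> real set) \<Rightarrow> nat \<Rightarrow> real \<Rightarrow> real" where
  "cc_pressure f J N t =
     lim (\<lambda>k. 1 / real k * ln (\<Sum>\<sigma>\<in>words N k. word_deriv_norm f J \<sigma> powr t))"

definition cc_exponent :: "(real \<Rightarrow> real) \<Rightarrow> (nat \<Rightarrow> real set) \<Rightarrow> nat \<Rightarrow> real" where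
  "cc_exponent f J N = (THE h. 0 < h \<and> cc_pressure f J N h = 0)"

definition banach_limit :: "((nat \<Rightarrow> real) \<Rightarrow> real) \<Rightarrow> bool" where
  "banach_limit L \<longleftrightarrow>
     (\<forall>x y a b. Bseq x \<longrightarrow> Bseq y \<longrightarrow> L (\<lambda>n. a * x n + b * y n) = a * L x + b * L y) \<and>
     (\<forall>x. Bseq x \<longrightarrow> L (\<lambda>n. x (Suc n)) = L x) \<and>
     (\<forall>x. Bseq x \<longrightarrow> liminf (\<lambda>n. ereal (x n)) \<le> ereal (L x) \<and>
                      ereal (L x) \<le> limsup (\<lambda>n. ereal (x n)))"

definition cyl_ratio ::
  "(real \<Rightarrow> real) \<Rightarrow> (nat \<Rightarrow> real set) \<Rightarrow> nat \<Rightarrow> nat \<Rightarrow> nat list \<Rightarrow> real" where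
  "cyl_ratio f J N n \<sigma> =
     (\<Sum>\<tau>\<in>words N n. diameter (word_interval f J (\<sigma> @ \<tau>)) powr cc_exponent f J N) /
     (\<Sum>\<tau>\<in>words N (length \<sigma> + n). diameter (word_interval f J \<tau>) powr cc_exponent f J N)"

text \<open>
  \<open>\<gamma>\<close> is a Borel probability measure on the space of infinite words (a subspace of
  \<open>nat \<Rightarrow> nat\<close> with the product topology) whose values on cylinders are the Banach limits of
  the ratios above; these sequences start at index 1, whence \<^const>\<open>Suc\<close>.
\<close>

definition gibbs_coding_measure ::
  "(real \<Rightarrow> real) \<Rightarrow> (nat \<Rightarrow> real set) \<Rightarrow> nat \<Rightarrow> ((nat \<Rightarrow> real) \<Rightarrow> real) \<Rightarrow>
   (nat \<Rightarrow> nat) measure \<Rightarrow> bool" where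
  "gibbs_coding_measure f J N L \<gamma> \<longleftrightarrow>
     prob_space \<gamma> \<and> sets \<gamma> = sets (restrict_space borel (inf_words N)) \<and>
     (\<forall>k. \<forall>\<sigma>\<in>words N k. measure \<gamma> (cylinder N \<sigma>) = L (\<lambda>n. cyl_ratio f J N (Suc n) \<sigma>))"

definition gibbs_like_measure ::
  "(real \<Rightarrow> real) \<Rightarrow> (nat \<Rightarrow> real set) \<Rightarrow> nat \<Rightarrow> ((nat \<Rightarrow> real) \<Rightarrow> real) \<Rightarrow>
   real measure \<Rightarrow> bool" where
  "gibbs_like_measure f J N L \<mu> \<longleftrightarrow>
     (\<exists>\<gamma>. gibbs_coding_measure f J N L \<gamma> \<and> \<mu> = distr \<gamma> borel (coding f J))"

definition multifractal_pressure ::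
  "(real \<Rightarrow> real) \<Rightarrow> (nat \<Rightarrow> real set) \<Rightarrow> nat \<Rightarrow> real measure \<Rightarrow> real \<Rightarrow> real \<Rightarrow> real" where
  "multifractal_pressure f J N \<mu> q t =
     lim (\<lambda>k. 1 / real k *
       ln (\<Sum>\<sigma>\<in>words N k. measure \<mu> (word_interval f J \<sigma>) powr q * word_deriv_norm f J \<sigma> powr t))"

definition temperature ::
  "(real \<Rightarrow> real) \<Rightarrow> (nat \<Rightarrow> real set) \<Rightarrow> nat \<Rightarrow> real measure \<Rightarrow> real \<Rightarrow> real" where
  "temperature f J N \<mu> q = (THE t. multifractal_pressure f J N \<mu> q t = 0)"

definition real_norm :: "(real \<Rightarrow> real) \<Rightarrow> bool" where
  "real_norm \<nu> \<longleftrightarrow>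
     (\<forall>x. 0 \<le> \<nu> x) \<and> (\<forall>x. \<nu> x = 0 \<longleftrightarrow> x = 0) \<and>
     (\<forall>c x. \<nu> (c * x) = \<bar>c\<bar> * \<nu> x) \<and> (\<forall>x y. \<nu> (x + y) \<le> \<nu> x + \<nu> y)"

definition quant_error :: "(real \<Rightarrow> real) \<Rightarrow> real measure \<Rightarrow> real \<Rightarrow> nat \<Rightarrow> real" where
  "quant_error \<nu> \<mu> r n =
     enn2real (INF \<alpha>\<in>{\<alpha>. \<alpha> \<noteq> {} \<and> finite \<alpha> \<and> card \<alpha> \<le> n}.
       \<integral>\<^sup>+ x. ennreal ((INF a\<in>\<alpha>. \<nu> (x - a)) powr r) \<partial>\<mu>)"

definition has_quantization_dimension ::
  "(real \<Rightarrow> real) \<Rightarrow> real measure \<Rightarrow> real \<Rightarrow> real \<Rightarrow> bool" where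
  "has_quantization_dimension \<nu> \<mu> r D \<longleftrightarrow>
     (\<lambda>n. r * ln (real n) / (- ln (quant_error \<nu> \<mu> r n))) \<longlonglongrightarrow> D"

definition lower_quantization_coefficient ::
  "(real \<Rightarrow> real) \<Rightarrow> real measure \<Rightarrow> real \<Rightarrow> real \<Rightarrow> ereal" where
  "lower_quantization_coefficient \<nu> \<mu> r \<kappa> =
     liminf (\<lambda>n. ereal (real n * quant_error \<nu> \<mu> r n powr (\<kappa> / r)))"

end

theory Submission
  imports Defs
begin

text \<open>
  The quantization dimension does not depend on the order \<open>r\<close>: it always equals the exponent \<open>h\<close> at
  which the pressure of the derivatives vanishes.  The reason is that the Gibbs-like measure is
  Ahlfors regular of dimension \<open>h\<close>.

  Bounded distortion (\<open>bounded_distortion\<close>) makes every word map \<open>\<phi>\<^sub>\<sigma>\<close> bi-Lipschitz with ratio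
  \<open>M \<sigma> = \<parallel>\<phi>\<^sub>\<sigma>'\<parallel>\<close> up to a constant independent of \<open>\<sigma>\<close>, whence \<open>M\<close> is multiplicative under
  concatenation up to a constant.  For such weights the logarithms of the partition sums
  \<open>\<Sum> M \<sigma> powr t\<close> over words of length \<open>k\<close> are additive in \<open>k\<close> up to a constant, so they grow linearly
  with a bounded error, the rate \<open>Q t\<close> is strictly decreasing in \<open>t\<close>, and at its zero \<open>h\<close> the
  partition sums are bounded above and below.  The ratios that define the measure of a cylinder are
  then comparable to \<open>M \<sigma> powr h\<close> uniformly in \<open>n\<close>, and a Banach limit preserves such bounds
  (\<open>cylinder_measure_bounds\<close>).

  There are two consequences.  First, the pressure weighted by powers of the measure is
  \<open>P q t = Q (h * q + t)\<close>, so the temperature function is the affine function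
  \<open>\<beta> q = h * (1 - q)\<close> (\<open>temperature_eq\<close>).  The quotient \<open>\<beta> q / (1 - q)\<close> is then the
  constant \<open>h\<close>, which gives existence and uniqueness of \<open>\<kappa>\<close> at once, and \<open>\<beta> q = r * q\<close> holds at
  \<open>q = h / (r + h)\<close>.  Secondly, since distinct branches are separated by a gap, a ball of radius
  \<open>\<rho> \<le> 1\<close> centred on the cookie-cutter set contains, and any ball of that radius is up to a null set
  contained in, an interval of diameter comparable to \<open>\<rho>\<close>.  Hence balls have mass comparable to
  \<open>\<rho> powr h\<close>.

  For an Ahlfors regular measure the quantization errors are comparable to
  \<open>n powr (- r / h)\<close> (\<open>quant_error_asymptotics\<close>): \<open>n\<close> balls of radius a small multiple of
  \<open>n powr (- 1 / h)\<close> miss half of the mass, while a maximal separated set at a large multiple of this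
  scale has at most \<open>n\<close> points.  This yields the dimension and the positive lower coefficient.
\<close>

section \<open>Pressure of quasi-multiplicative weights on words\<close>

text \<open>
  This is the form of Fekete's lemma for sequences that are additive up to a constant.  Comparing
  \<open>a (m * n)\<close> both with \<open>m * a n\<close> and with \<open>n * a m\<close> shows that the averages form a Cauchy sequence
  with rate \<open>C / n\<close>; besides the limit one therefore gets a bound on the error that is uniform in
  \<open>n\<close>.  This uniform error is what later makes the partition sums at the critical exponent bounded.
\<close>

lemma quasi_additive_growth_rate:
  fixes a :: "nat \<Rightarrow> real"
  assumes quasi: "\<And>m n. \<bar>a (m + n) - a m - a n\<bar> \<le> C"
  obtains A where "(\<lambda>n. 1 / real n * a n) \<longlonglongrightarrow> A" and "\<And>n. \<bar>a n - real n * A\<bar> \<le> C"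
proof -
  have C0: "0 \<le> C" using quasi[of 0 0] by linarith
  have mult: "\<bar>a (Suc k * n) - real (Suc k) * a n\<bar> \<le> real k * C" for k n
  proof (induction k)
    case (Suc k)
    have "\<bar>a (n + Suc k * n) - a n - a (Suc k * n)\<bar> \<le> C" by (rule quasi)
    with Suc show ?case by (simp add: algebra_simps)
  qed auto
  have mult': "\<bar>a (k * n) - real k * a n\<bar> \<le> real k * C" if k1: "1 \<le> k" for k n
  proof -
    obtain k' where k: "k = Suc k'" using k1 by (cases k) auto
    have "real k' * C \<le> real k * C" using C0 k by (intro mult_right_mono) auto
    with mult[of k' n] show ?thesis unfolding k by (rule order_trans)
  qed
  have close: "\<bar>1 / real n * a n - 1 / real m * a m\<bar> \<le> C / real n + C / real m"
    if "1 \<le> n" "1 \<le> m" for m n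
  proof -
    have "\<bar>a (m * n) - real m * a n\<bar> \<le> real m * C" "\<bar>a (m * n) - real n * a m\<bar> \<le> real n * C"
      using mult'[of m n] mult'[of n m] that by (auto simp: mult.commute)
    then have "\<bar>real m * a n - real n * a m\<bar> \<le> (real m + real n) * C"
      by (simp add: algebra_simps)
    then have "\<bar>real m * a n - real n * a m\<bar> / (real m * real n)
        \<le> (real m + real n) * C / (real m * real n)"
      by (intro divide_right_mono) auto
    moreover have "1 / real n * a n - 1 / real m * a m
        = (real m * a n - real n * a m) / (real m * real n)"
      "(real m + real n) * C / (real m * real n) = C / real n + C / real m"
      using that by (auto simp: field_simps)
    ultimately show ?thesis by (simp add: abs_divide abs_mult)
  qed
  have "Cauchy (\<lambda>n. 1 / real n * a n)"
  proof (rule metric_CauchyI)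
    fix e :: real assume e: "0 < e"
    obtain M where M: "2 * C / e < real M" using reals_Archimedean2 by blast
    have small: "C / real n < e / 2" if "Suc M \<le> n" for n
    proof -
      have "2 * C / e < real n" using M that by linarith
      then show ?thesis using e that by (simp add: field_simps)
    qed
    show "\<exists>M. \<forall>m\<ge>M. \<forall>n\<ge>M. dist (1 / real m * a m) (1 / real n * a n) < e"
    proof (intro exI allI impI)
      fix m n assume "Suc M \<le> m" "Suc M \<le> n"
      then show "dist (1 / real m * a m) (1 / real n * a n) < e"
        using close[of m n] small[of m] small[of n] unfolding dist_real_def by linarith
    qed
  qed
  then obtain A where A: "(\<lambda>n. 1 / real n * a n) \<longlonglongrightarrow> A"
    using real_Cauchy_convergent convergent_def by blast
  have "\<bar>a n - real n * A\<bar> \<le> C" for n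
  proof (cases "n = 0")
    case True
    then show ?thesis using quasi[of 0 0] by simp
  next
    case False
    have "(\<lambda>m. \<bar>1 / real n * a n - 1 / real m * a m\<bar>) \<longlonglongrightarrow> \<bar>1 / real n * a n - A\<bar>"
      by (intro tendsto_intros A)
    moreover have "(\<lambda>m. C / real n + C / real m) \<longlonglongrightarrow> C / real n + 0"
      by (intro tendsto_intros lim_const_over_n)
    ultimately have "\<bar>1 / real n * a n - A\<bar> \<le> C / real n + 0"
      by (rule LIMSEQ_le) (use close False in \<open>auto intro!: exI[of _ 1]\<close>)
    then have "real n * \<bar>1 / real n * a n - A\<bar> \<le> real n * (C / real n)"
      by (intro mult_left_mono) auto
    moreover have "real n * \<bar>1 / real n * a n - A\<bar> = \<bar>a n - real n * A\<bar>"
    proof -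
      have "real n * \<bar>1 / real n * a n - A\<bar> = \<bar>real n * (1 / real n * a n - A)\<bar>"
        by (simp add: abs_mult)
      then show ?thesis using False by (simp add: algebra_simps)
    qed
    ultimately show ?thesis using False by simp
  qed
  with A that show thesis by blast
qed

lemma powr_le_of_comparable:
  fixes x y D t :: real
  assumes "0 < x" "0 < y" "0 < D" "x \<le> D * y" "y \<le> D * x"
  shows "x powr t \<le> D powr \<bar>t\<bar> * y powr t"
proof (cases "0 \<le> t")
  case True
  then have "x powr t \<le> (D * y) powr t" using assms by (intro powr_mono2) auto
  then show ?thesis using assms True by (simp add: powr_mult)
next
  case False
  have "x powr t \<le> (y / D) powr t"
    using assms False by (intro powr_mono2') (auto simp: field_simps)
  also have "\<dots> = D powr \<bar>t\<bar> * y powr t"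
    using assms False by (simp add: powr_divide powr_minus field_simps)
  finally show ?thesis .
qed

lemma finite_words: "finite (words N k)"
proof -
  have "words N k = {\<sigma>. set \<sigma> \<subseteq> {1..N} \<and> length \<sigma> = k}" by (auto simp: words_def)
  then show ?thesis using finite_lists_length_eq[of "{1..N}" k] by simp
qed

lemma card_words: "card (words N k) = N ^ k"
proof -
  have "words N k = {\<sigma>. set \<sigma> \<subseteq> {1..N} \<and> length \<sigma> = k}" by (auto simp: words_def)
  then show ?thesis using card_lists_length_eq[of "{1..N}" k] by simp
qed

lemma words_nonempty: "1 \<le> N \<Longrightarrow> words N k \<noteq> {}"
  using card_words[of N k] by force

text \<open>
  Cutting a word at position \<open>m\<close> is a bijection onto pairs of words.
\<close>

lemma sum_words_add:
  "(\<Sum>\<rho>\<in>words N (m + n). g \<rho>) = (\<Sum>\<sigma>\<in>words N m. \<Sum>\<tau>\<in>words N n. g (\<sigma> @ \<tau>))"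
proof -
  have inj: "inj_on (\<lambda>(\<sigma>, \<tau>). \<sigma> @ \<tau>) (words N m \<times> words N n)"
    by (auto simp: inj_on_def words_def)
  have "(\<lambda>(\<sigma>, \<tau>). \<sigma> @ \<tau>) ` (words N m \<times> words N n) = words N (m + n)" (is "?L = ?R")
  proof
    show "?R \<subseteq> ?L"
    proof
      fix \<rho> assume "\<rho> \<in> ?R"
      then have "(take m \<rho>, drop m \<rho>) \<in> words N m \<times> words N n"
        by (auto simp: words_def dest: in_set_takeD in_set_dropD)
      moreover have "\<rho> = (\<lambda>(\<sigma>, \<tau>). \<sigma> @ \<tau>) (take m \<rho>, drop m \<rho>)" by simp
      ultimately show "\<rho> \<in> ?L" by blast
    qed
  next
    show "?L \<subseteq> ?R" by (clarsimp simp: words_def)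
  qed
  with inj have "(\<Sum>\<rho>\<in>words N (m + n). g \<rho>)
      = (\<Sum>p\<in>words N m \<times> words N n. g (case p of (\<sigma>, \<tau>) \<Rightarrow> \<sigma> @ \<tau>))"
    by (metis (no_types, lifting) sum.reindex_cong)
  then show ?thesis by (simp add: sum.cartesian_product split_def)
qed

text \<open>
  Exponential growth rates ignore bounded factors.  It is through this lemma that the pressure
  weighted by the measure is reduced to the pressure of the derivatives alone.
\<close>

lemma growth_rate_cong:
  fixes u v :: "nat \<Rightarrow> nat list \<Rightarrow> real"
  assumes "1 \<le> N" "0 < C"
    and pos: "\<And>k \<sigma>. \<sigma> \<in> words N k \<Longrightarrow> 0 < v k \<sigma>"
    and lo: "\<And>k \<sigma>. \<sigma> \<in> words N k \<Longrightarrow> v k \<sigma> / C \<le> u k \<sigma>"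
    and hi: "\<And>k \<sigma>. \<sigma> \<in> words N k \<Longrightarrow> u k \<sigma> \<le> C * v k \<sigma>"
    and lim: "(\<lambda>k. 1 / real k * ln (\<Sum>\<sigma>\<in>words N k. v k \<sigma>)) \<longlonglongrightarrow> A"
  shows "(\<lambda>k. 1 / real k * ln (\<Sum>\<sigma>\<in>words N k. u k \<sigma>)) \<longlonglongrightarrow> A"
proof -
  define V where "V k = (\<Sum>\<sigma>\<in>words N k. v k \<sigma>)" for k
  define U where "U k = (\<Sum>\<sigma>\<in>words N k. u k \<sigma>)" for k
  have V: "0 < V k" for k
    unfolding V_def using pos words_nonempty[OF assms(1)] by (intro sum_pos finite_words) auto
  have lo': "V k / C \<le> U k" for k
    unfolding V_def U_def sum_divide_distrib by (intro sum_mono lo)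
  have hi': "U k \<le> C * V k" for k
    unfolding V_def U_def sum_distrib_left by (intro sum_mono hi)
  have U: "0 < U k" for k using lo'[of k] V[of k] \<open>0 < C\<close> by (meson divide_pos_pos less_le_trans)
  have "ln (V k / C) \<le> ln (U k)" "ln (U k) \<le> ln (C * V k)" for k
    using lo' hi' U V \<open>0 < C\<close> by (auto intro!: ln_mono)
  moreover have "ln (V k / C) = ln (V k) - ln C" "ln (C * V k) = ln (V k) + ln C" for k
    using V[of k] \<open>0 < C\<close> by (simp_all add: ln_div ln_mult)
  ultimately have b: "ln (V k) - ln C \<le> ln (U k)" "ln (U k) \<le> ln (V k) + ln C" for k
    by metis+
  have 1: "(\<lambda>k. 1 / real k * ln (V k) - ln C / real k) \<longlonglongrightarrow> A - 0"
    using lim unfolding V_def by (intro tendsto_intros lim_const_over_n)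
  have 2: "(\<lambda>k. 1 / real k * ln (V k) + ln C / real k) \<longlonglongrightarrow> A + 0"
    using lim unfolding V_def by (intro tendsto_intros lim_const_over_n)
  have "(\<lambda>k. 1 / real k * ln (U k)) \<longlonglongrightarrow> A"
  proof (rule tendsto_sandwich)
    show "\<forall>\<^sub>F k in sequentially. 1 / real k * ln (V k) - ln C / real k \<le> 1 / real k * ln (U k)"
      using b(1) by (auto intro!: always_eventually divide_right_mono simp flip: diff_divide_distrib)
    show "\<forall>\<^sub>F k in sequentially. 1 / real k * ln (U k) \<le> 1 / real k * ln (V k) + ln C / real k"
      using b(2) by (auto intro!: always_eventually divide_right_mono simp flip: add_divide_distrib)
  qed (use 1 2 in auto)
  then show ?thesis unfolding U_def .
qed

text \<open>
  The thermodynamic formalism below depends on the cookie-cutter map only through these properties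
  of the numbers \<open>w \<sigma>\<close>, for which the norms of the derivatives of the word maps will be taken: they
  decay at exponential rates bounded on both sides, and they are multiplicative under concatenation
  up to the factor \<open>D\<close> that bounded distortion provides.
\<close>

locale quasi_multiplicative_weight =
  fixes N :: nat and w :: "nat list \<Rightarrow> real" and D \<eta> \<theta> :: real
  assumes two_letters: "2 \<le> N"
    and D_ge_1: "1 \<le> D"
    and \<eta>_pos: "0 < \<eta>" and \<theta>_less_1: "\<theta> < 1"
    and weight_lower: "set \<sigma> \<subseteq> {1..N} \<Longrightarrow> \<eta> ^ length \<sigma> \<le> w \<sigma>"
    and weight_upper: "set \<sigma> \<subseteq> {1..N} \<Longrightarrow> w \<sigma> \<le> \<theta> ^ length \<sigma>"
    and weight_append_lower:
      "set \<sigma> \<subseteq> {1..N} \<Longrightarrow> set \<tau> \<subseteq> {1..N} \<Longrightarrow> w \<sigma> * w \<tau> \<le> D * w (\<sigma> @ \<tau>)"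
    and weight_append_upper:
      "set \<sigma> \<subseteq> {1..N} \<Longrightarrow> set \<tau> \<subseteq> {1..N} \<Longrightarrow> w (\<sigma> @ \<tau>) \<le> D * (w \<sigma> * w \<tau>)"
begin

lemma weight_pos: "set \<sigma> \<subseteq> {1..N} \<Longrightarrow> 0 < w \<sigma>"
  using weight_lower[of \<sigma>] \<eta>_pos by (meson less_le_trans zero_less_power)

lemma \<eta>_le_\<theta>: "\<eta> \<le> \<theta>"
  using weight_lower[of "[1]"] weight_upper[of "[1]"] two_letters by simp

lemma \<theta>_pos: "0 < \<theta>"
  using \<eta>_pos \<eta>_le_\<theta> by linarith

definition partition_sum :: "real \<Rightarrow> nat \<Rightarrow> real" where
  "partition_sum t k = (\<Sum>\<sigma>\<in>words N k. w \<sigma> powr t)"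

definition pressure :: "real \<Rightarrow> real" where
  "pressure t = lim (\<lambda>k. 1 / real k * ln (partition_sum t k))"

lemma partition_sum_pos: "0 < partition_sum t k"
  unfolding partition_sum_def
proof (intro sum_pos finite_words words_nonempty)
  fix \<sigma> assume "\<sigma> \<in> words N k"
  then show "0 < w \<sigma> powr t" using weight_pos[of \<sigma>] by (auto simp: words_def)
qed (use two_letters in simp)

lemma powr_append_bounds:
  assumes "set \<sigma> \<subseteq> {1..N}" "set \<tau> \<subseteq> {1..N}"
  shows "w (\<sigma> @ \<tau>) powr t \<le> D powr \<bar>t\<bar> * (w \<sigma> powr t * w \<tau> powr t)"
    and "w \<sigma> powr t * w \<tau> powr t \<le> D powr \<bar>t\<bar> * w (\<sigma> @ \<tau>) powr t"
proof -
  have p: "0 < w \<sigma>" "0 < w \<tau>" "0 < w (\<sigma> @ \<tau>)" "0 < D"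
    using assms D_ge_1 by (simp_all add: weight_pos)
  note b = weight_append_lower[OF assms] weight_append_upper[OF assms]
  show "w (\<sigma> @ \<tau>) powr t \<le> D powr \<bar>t\<bar> * (w \<sigma> powr t * w \<tau> powr t)"
    using powr_le_of_comparable[of "w (\<sigma> @ \<tau>)" "w \<sigma> * w \<tau>" D t] p b by (simp add: powr_mult)
  show "w \<sigma> powr t * w \<tau> powr t \<le> D powr \<bar>t\<bar> * w (\<sigma> @ \<tau>) powr t"
    using powr_le_of_comparable[of "w \<sigma> * w \<tau>" "w (\<sigma> @ \<tau>)" D t] p b by (simp add: powr_mult)
qed

lemma sum_extensions_bounds:
  assumes "set \<sigma> \<subseteq> {1..N}"
  shows "(\<Sum>\<tau>\<in>words N k. w (\<sigma> @ \<tau>) powr t) \<le> D powr \<bar>t\<bar> * (w \<sigma> powr t * partition_sum t k)"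
    and "w \<sigma> powr t * partition_sum t k \<le> D powr \<bar>t\<bar> * (\<Sum>\<tau>\<in>words N k. w (\<sigma> @ \<tau>) powr t)"
  using powr_append_bounds[OF assms]
  by (auto simp: partition_sum_def sum_distrib_left words_def intro!: sum_mono)

lemma partition_sum_add_bounds:
  shows "partition_sum t (m + n) \<le> D powr \<bar>t\<bar> * (partition_sum t m * partition_sum t n)"
    and "partition_sum t m * partition_sum t n \<le> D powr \<bar>t\<bar> * partition_sum t (m + n)"
proof -
  have "partition_sum t (m + n) \<le> (\<Sum>\<sigma>\<in>words N m. D powr \<bar>t\<bar> * (w \<sigma> powr t * partition_sum t n))"
    unfolding partition_sum_def[of t "m + n"] sum_words_add
    by (intro sum_mono sum_extensions_bounds) (auto simp: words_def)
  then show "partition_sum t (m + n) \<le> D powr \<bar>t\<bar> * (partition_sum t m * partition_sum t n)"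
    by (simp add: partition_sum_def[of t m] sum_distrib_left sum_distrib_right)
  have "(\<Sum>\<sigma>\<in>words N m. w \<sigma> powr t * partition_sum t n) \<le> D powr \<bar>t\<bar> * partition_sum t (m + n)"
    unfolding partition_sum_def[of t "m + n"] sum_words_add
      sum_distrib_left[of "D powr \<bar>t\<bar>" _ "words N m"]
    by (intro sum_mono sum_extensions_bounds) (auto simp: words_def)
  then show "partition_sum t m * partition_sum t n \<le> D powr \<bar>t\<bar> * partition_sum t (m + n)"
    by (simp add: partition_sum_def[of t m] sum_distrib_right)
qed

text \<open>
  Quasi-multiplicativity of the weight makes \<open>partition_sum t\<close> quasi-multiplicative in the word
  length, so its logarithm is quasi-additive with constant \<open>\<bar>t\<bar> * ln D\<close>.
\<close>

lemma pressure_limit: "(\<lambda>k. 1 / real k * ln (partition_sum t k)) \<longlonglongrightarrow> pressure t"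
  and ln_partition_sum_bound: "\<bar>ln (partition_sum t k) - real k * pressure t\<bar> \<le> \<bar>t\<bar> * ln D"
proof -
  have quasi: "\<bar>ln (partition_sum t (m + n)) - ln (partition_sum t m) - ln (partition_sum t n)\<bar>
      \<le> \<bar>t\<bar> * ln D" for m n
  proof -
    note p = partition_sum_pos[of t m] partition_sum_pos[of t n] partition_sum_pos[of t "m + n"]
    have D: "0 < D powr \<bar>t\<bar>" "ln (D powr \<bar>t\<bar>) = \<bar>t\<bar> * ln D" using D_ge_1 by (auto simp: ln_powr)
    have "ln (partition_sum t (m + n)) \<le> ln (D powr \<bar>t\<bar> * (partition_sum t m * partition_sum t n))"
      "ln (partition_sum t m * partition_sum t n) \<le> ln (D powr \<bar>t\<bar> * partition_sum t (m + n))"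
      using p D(1) partition_sum_add_bounds[of t m n] by (auto intro!: ln_mono)
    then show ?thesis using p D by (simp add: ln_mult)
  qed
  obtain A where A: "(\<lambda>k. 1 / real k * ln (partition_sum t k)) \<longlonglongrightarrow> A"
    "\<And>k. \<bar>ln (partition_sum t k) - real k * A\<bar> \<le> \<bar>t\<bar> * ln D"
    using quasi_additive_growth_rate[of "\<lambda>k. ln (partition_sum t k)", OF quasi] by blast
  moreover have "pressure t = A" unfolding pressure_def by (rule limI[OF A(1)])
  ultimately show "(\<lambda>k. 1 / real k * ln (partition_sum t k)) \<longlonglongrightarrow> pressure t"
    "\<bar>ln (partition_sum t k) - real k * pressure t\<bar> \<le> \<bar>t\<bar> * ln D" by auto
qed

text \<open>
  A word of length \<open>k\<close> has weight between \<open>\<eta> ^ k\<close> and \<open>\<theta> ^ k\<close>; raising the exponent by \<open>t' - t\<close>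
  multiplies every summand by a factor in the corresponding range.  The upper bound makes the
  pressure strictly decreasing, the lower bound makes it Lipschitz.
\<close>

lemma pressure_decrement:
  assumes "t \<le> t'"
  shows "pressure t' \<le> pressure t + (t' - t) * ln \<theta>"
    and "pressure t + (t' - t) * ln \<eta> \<le> pressure t'"
proof -
  define d where "d = t' - t"
  have "0 \<le> d" and t': "t' = t + d" using assms by (auto simp: d_def)
  have split: "w \<sigma> powr t' = w \<sigma> powr t * w \<sigma> powr d" for \<sigma> by (simp add: t' powr_add)
  have word: "w \<sigma> powr d \<le> (\<theta> ^ k) powr d" "(\<eta> ^ k) powr d \<le> w \<sigma> powr d"
    if "\<sigma> \<in> words N k" for \<sigma> k
  proof -
    have s: "set \<sigma> \<subseteq> {1..N}" "length \<sigma> = k" using that by (auto simp: words_def)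
    show "w \<sigma> powr d \<le> (\<theta> ^ k) powr d"
      using weight_upper[OF s(1)] weight_pos[OF s(1)] s(2) \<open>0 \<le> d\<close> by (intro powr_mono2) auto
    show "(\<eta> ^ k) powr d \<le> w \<sigma> powr d"
      using weight_lower[OF s(1)] \<eta>_pos s(2) \<open>0 \<le> d\<close> by (intro powr_mono2) auto
  qed
  have up: "partition_sum t' k \<le> partition_sum t k * (\<theta> ^ k) powr d" for k
    unfolding partition_sum_def sum_distrib_right split by (intro sum_mono mult_left_mono word) auto
  have low: "partition_sum t k * (\<eta> ^ k) powr d \<le> partition_sum t' k" for k
    unfolding partition_sum_def sum_distrib_right split by (intro sum_mono mult_left_mono word) auto
  have ln_pow: "ln ((x ^ k) powr d) = real k * (d * ln x)" if "0 < x" for x :: real and k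
    using that by (simp add: ln_powr ln_realpow)
  have pos: "0 < (\<theta> ^ k) powr d" "0 < (\<eta> ^ k) powr d" for k using \<theta>_pos \<eta>_pos by auto
  have "ln (partition_sum t' k) \<le> ln (partition_sum t k * (\<theta> ^ k) powr d)"
    "ln (partition_sum t k * (\<eta> ^ k) powr d) \<le> ln (partition_sum t' k)" for k
    using up low partition_sum_pos pos by (auto intro!: ln_mono)
  moreover have "ln (partition_sum t k * (\<theta> ^ k) powr d) = ln (partition_sum t k) + real k * (d * ln \<theta>)"
    "ln (partition_sum t k * (\<eta> ^ k) powr d) = ln (partition_sum t k) + real k * (d * ln \<eta>)" for k
    using pos[of k] partition_sum_pos[of t k] ln_pow[OF \<theta>_pos, of k] ln_pow[OF \<eta>_pos, of k]
    by (simp_all only: ln_mult_pos)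
  ultimately have lnb: "ln (partition_sum t' k) \<le> ln (partition_sum t k) + real k * (d * ln \<theta>)"
    "ln (partition_sum t k) + real k * (d * ln \<eta>) \<le> ln (partition_sum t' k)" for k
    by metis+
  have lim: "(\<lambda>k. 1 / real k * ln (partition_sum t k) + d * c) \<longlonglongrightarrow> pressure t + d * c" for c
    by (intro tendsto_intros pressure_limit)
  have avg: "1 / real k * (ln (partition_sum t k) + real k * c)
      = 1 / real k * ln (partition_sum t k) + c" if "1 \<le> k" for k c
    using that by (simp add: field_simps)
  have "pressure t' \<le> pressure t + d * ln \<theta>"
  proof (rule LIMSEQ_le[OF pressure_limit lim], intro exI allI impI)
    fix k :: nat assume "1 \<le> k"
    then show "1 / real k * ln (partition_sum t' k) \<le> 1 / real k * ln (partition_sum t k) + d * ln \<theta>"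
      using mult_left_mono[OF lnb(1)[of k], of "1 / real k"] avg by simp
  qed
  then show "pressure t' \<le> pressure t + (t' - t) * ln \<theta>" by (simp add: d_def)
  have "pressure t + d * ln \<eta> \<le> pressure t'"
  proof (rule LIMSEQ_le[OF lim pressure_limit], intro exI allI impI)
    fix k :: nat assume "1 \<le> k"
    then show "1 / real k * ln (partition_sum t k) + d * ln \<eta> \<le> 1 / real k * ln (partition_sum t' k)"
      using mult_left_mono[OF lnb(2)[of k], of "1 / real k"] avg by simp
  qed
  then show "pressure t + (t' - t) * ln \<eta> \<le> pressure t'" by (simp add: d_def)
qed

lemma strict_antimono_pressure: "t < t' \<Longrightarrow> pressure t' < pressure t"
  using pressure_decrement(1)[of t t'] \<theta>_pos \<theta>_less_1
  by (smt (verit) ln_less_zero mult_pos_neg)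

lemma pressure_inj: "pressure t = pressure t' \<longleftrightarrow> t = t'"
  using strict_antimono_pressure by (metis linorder_neqE less_irrefl)

lemma pressure_0: "pressure 0 = ln (real N)"
proof -
  have "partition_sum 0 k = real N ^ k" for k
  proof -
    have "partition_sum 0 k = (\<Sum>\<sigma>\<in>words N k. 1)"
      unfolding partition_sum_def
    proof (intro sum.cong refl)
      fix \<sigma> assume "\<sigma> \<in> words N k"
      then have "0 < w \<sigma>" by (intro weight_pos) (auto simp: words_def)
      then show "w \<sigma> powr 0 = 1" by simp
    qed
    then show ?thesis by (simp add: card_words)
  qed
  then have "\<bar>real k * ln (real N) - real k * pressure 0\<bar> \<le> 0" for k
    using ln_partition_sum_bound[of 0 k] two_letters by (simp add: ln_realpow)
  from this[of 1] show ?thesis by simp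
qed

lemma continuous_pressure: "continuous_on S pressure"
proof -
  have "\<bar>pressure t' - pressure t\<bar> \<le> - ln \<eta> * \<bar>t' - t\<bar>" if "t \<le> t'" for t t'
  proof -
    have "(t' - t) * ln \<theta> \<le> 0"
      using that \<theta>_pos \<theta>_less_1 by (intro mult_nonneg_nonpos) auto
    with pressure_decrement[OF that] that show ?thesis by (simp add: algebra_simps)
  qed
  then have "\<bar>pressure t' - pressure t\<bar> \<le> - ln \<eta> * \<bar>t' - t\<bar>" for t t'
    by (metis abs_minus_commute linear)
  then have "(- ln \<eta>)-lipschitz_on UNIV pressure"
    using \<eta>_pos \<eta>_le_\<theta> \<theta>_less_1 by (intro lipschitz_onI) (auto simp: dist_real_def)
  then show ?thesis using lipschitz_on_continuous_on continuous_on_subset by blast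
qed

text \<open>
  The pressure is positive at \<open>0\<close>, where it counts the words, and decreases at least linearly.
\<close>

lemma pressure_zero:
  obtains h where "0 < h" "pressure h = 0"
proof -
  define T where "T = ln (real N) / - ln \<theta>"
  have "0 < - ln \<theta>" "0 < ln (real N)" using \<theta>_pos \<theta>_less_1 two_letters by auto
  then have T: "0 < T" "T * ln \<theta> = - ln (real N)" by (auto simp: T_def field_simps)
  have "pressure T \<le> 0" using pressure_decrement(1)[of 0 T] T pressure_0 by simp
  moreover have p0: "0 < pressure 0" using pressure_0 two_letters by simp
  ultimately obtain h where h: "0 \<le> h" "h \<le> T" "pressure h = 0"
    using IVT2'[of pressure T 0 0] continuous_pressure T(1) by auto
  moreover have "h \<noteq> 0" using h(3) p0 by auto
  ultimately show thesis using that[of h] by simp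
qed

text \<open>
  At a zero of the pressure the uniform error bound of the growth rate leaves only the constant.
\<close>

lemma partition_sum_bounds_at_zero:
  assumes "pressure h = 0"
  shows "partition_sum h k \<le> D powr \<bar>h\<bar>" "1 \<le> D powr \<bar>h\<bar> * partition_sum h k"
proof -
  have "\<bar>ln (partition_sum h k)\<bar> \<le> ln (D powr \<bar>h\<bar>)"
    using ln_partition_sum_bound[of h k] assms D_ge_1 by (simp add: ln_powr)
  moreover have D: "0 < D powr \<bar>h\<bar>" using D_ge_1 by simp
  moreover have "ln (D powr \<bar>h\<bar> * partition_sum h k)
      = ln (D powr \<bar>h\<bar>) + ln (partition_sum h k)"
    using D partition_sum_pos[of h k] by (intro ln_mult_pos) auto
  ultimately have "ln (partition_sum h k) \<le> ln (D powr \<bar>h\<bar>)"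
    "ln 1 \<le> ln (D powr \<bar>h\<bar> * partition_sum h k)"
    by (simp_all only: ln_one)
  then show "partition_sum h k \<le> D powr \<bar>h\<bar>" "1 \<le> D powr \<bar>h\<bar> * partition_sum h k"
    using D partition_sum_pos[of h k] ln_le_cancel_iff mult_pos_pos zero_less_one by blast+
qed

end

section \<open>Quantization of Ahlfors regular measures\<close>

lemma real_norm_eq:
  assumes "real_norm \<nu>"
  shows "\<nu> x = \<nu> 1 * \<bar>x\<bar>" and "0 < \<nu> 1"
proof -
  have "\<nu> (x * 1) = \<bar>x\<bar> * \<nu> 1" using assms unfolding real_norm_def by blast
  then show "\<nu> x = \<nu> 1 * \<bar>x\<bar>" by simp
  have "0 \<le> \<nu> 1" "\<nu> 1 \<noteq> 0" using assms unfolding real_norm_def by auto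
  then show "0 < \<nu> 1" by simp
qed

text \<open>
  That \<open>E\<close> carries the measure is expressed by its closed supersets, because the quantizers
  constructed below cover \<open>E\<close> by finitely many closed balls.  The lower bound on balls is required at the points
  of \<open>E\<close> only, the upper bound at all points because quantizers may lie anywhere.
\<close>

locale ahlfors_regular = prob_space \<mu> for \<mu> :: "real measure" +
  fixes E :: "real set" and h C :: real
  assumes sets_borel: "sets \<mu> = sets borel"
    and bounded_support: "bounded E"
    and full: "\<And>A. closed A \<Longrightarrow> E \<subseteq> A \<Longrightarrow> measure \<mu> A = 1"
    and h_pos: "0 < h" and C_pos: "0 < C"
    and ball_upper: "\<And>x \<rho>. 0 < \<rho> \<Longrightarrow> measure \<mu> (cball x \<rho>) \<le> C * \<rho> powr h"
    and ball_lower: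
      "\<And>x \<rho>. x \<in> E \<Longrightarrow> 0 < \<rho> \<Longrightarrow> \<rho> \<le> 1 \<Longrightarrow> \<rho> powr h \<le> C * measure \<mu> (cball x \<rho>)"
begin

lemma space_UNIV: "space \<mu> = UNIV"
  using sets_eq_imp_space_eq[OF sets_borel] by simp

lemma closed_in_sets: "closed A \<Longrightarrow> A \<in> sets \<mu>"
  by (simp add: sets_borel borel_closed)

lemma cball_in_sets: "cball a \<rho> \<in> sets \<mu>"
  by (simp add: closed_in_sets)

text \<open>
  Balls of half the separation are disjoint, each has mass at least \<open>(\<epsilon> / 2) powr h / C\<close>, and the
  total mass is one.
\<close>

lemma card_separated_le:
  assumes "0 < \<epsilon>" "\<epsilon> \<le> 1" "F \<subseteq> E" "finite F"
    and sep: "\<And>a b. a \<in> F \<Longrightarrow> b \<in> F \<Longrightarrow> a \<noteq> b \<Longrightarrow> \<epsilon> < dist a b"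
  shows "real (card F) \<le> C * (2 / \<epsilon>) powr h"
proof -
  have disj: "disjoint_family_on (\<lambda>a. cball a (\<epsilon> / 2)) F"
  proof (unfold disjoint_family_on_def, intro ballI impI)
    fix a b assume ab: "a \<in> F" "b \<in> F" "a \<noteq> b"
    have False if "x \<in> cball a (\<epsilon> / 2)" "x \<in> cball b (\<epsilon> / 2)" for x
    proof -
      have "dist a x \<le> \<epsilon> / 2" "dist b x \<le> \<epsilon> / 2" using that by auto
      then have "dist a b \<le> \<epsilon>" using dist_triangle2[of a b x] by linarith
      with sep[OF ab] show False by simp
    qed
    then show "cball a (\<epsilon> / 2) \<inter> cball b (\<epsilon> / 2) = {}" by blast
  qed
  have "real (card F) * ((\<epsilon> / 2) powr h / C) = (\<Sum>a\<in>F. (\<epsilon> / 2) powr h / C)" by simp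
  also have "\<dots> \<le> (\<Sum>a\<in>F. measure \<mu> (cball a (\<epsilon> / 2)))"
    using ball_lower[of _ "\<epsilon> / 2"] assms C_pos
    by (intro sum_mono) (auto simp: field_simps subset_iff)
  also have "\<dots> = measure \<mu> (\<Union>a\<in>F. cball a (\<epsilon> / 2))"
    using disj \<open>finite F\<close> by (intro finite_measure_finite_Union[symmetric] image_subsetI cball_in_sets)
  also have "\<dots> \<le> 1" by simp
  finally have "real (card F) * (\<epsilon> / 2) powr h \<le> C" using C_pos by (simp add: field_simps)
  moreover have "(2 / \<epsilon>) powr h * (\<epsilon> / 2) powr h = 1"
    using \<open>0 < \<epsilon>\<close> by (simp add: powr_mult[symmetric])
  then have "real (card F) = real (card F) * (\<epsilon> / 2) powr h * (2 / \<epsilon>) powr h"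
    by (simp only: mult.assoc mult.commute[of "(2 / \<epsilon>) powr h"] mult_1_right)
  ultimately show ?thesis
    by (metis mult_right_mono powr_ge_zero)
qed

text \<open>
  A separated subset of maximal cardinality is a net; the maximum exists by the preceding bound.
\<close>

lemma finite_net:
  assumes "0 < \<epsilon>" "\<epsilon> \<le> 1"
  obtains F where "finite F" "F \<noteq> {}" "real (card F) \<le> C * (2 / \<epsilon>) powr h"
    "E \<subseteq> (\<Union>a\<in>F. cball a \<epsilon>)"
proof -
  define P where "P F \<longleftrightarrow> F \<subseteq> E \<and> finite F \<and> (\<forall>a\<in>F. \<forall>b\<in>F. a \<noteq> b \<longrightarrow> \<epsilon> < dist a b)"
    for F
  have card_le: "real (card F) \<le> C * (2 / \<epsilon>) powr h" if "P F" for F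
    using that assms by (intro card_separated_le) (auto simp: P_def)
  obtain b :: nat where "C * (2 / \<epsilon>) powr h \<le> real b" using real_arch_simple by blast
  then have "card F \<le> b" if "P F" for F
    using card_le[OF that] by linarith
  moreover have "P {}" by (simp add: P_def)
  ultimately have "\<exists>F. P F \<and> (\<forall>F'. P F' \<longrightarrow> card F' \<le> card F)"
    using ex_has_greatest_nat[of P "{}" card "Suc b", OF \<open>P {}\<close>] by (simp add: less_Suc_eq_le)
  then obtain F where F: "P F" "\<And>F'. P F' \<Longrightarrow> card F' \<le> card F"
    by blast
  have cover: "E \<subseteq> (\<Union>a\<in>F. cball a \<epsilon>)"
  proof (rule subsetI, rule ccontr)
    fix x assume x: "x \<in> E" "x \<notin> (\<Union>a\<in>F. cball a \<epsilon>)"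
    then have far: "\<epsilon> < dist a x" if "a \<in> F" for a
      using that x(2) by (meson UN_I mem_cball not_le)
    have "x \<notin> F" using far[of x] \<open>0 < \<epsilon>\<close> by auto
    moreover have "P (insert x F)" using F(1) x(1) far by (auto simp: P_def dist_commute)
    moreover have "finite F" using F(1) by (simp add: P_def)
    ultimately show False using F(2)[of "insert x F"] by simp
  qed
  have "F \<noteq> {}"
  proof
    assume "F = {}"
    then have "measure \<mu> {} = 1" using cover by (intro full) auto
    then show False by simp
  qed
  with that F(1) card_le[OF F(1)] cover show thesis by (auto simp: P_def)
qed

context
  fixes \<nu> :: "real \<Rightarrow> real" and r :: real
  assumes norm: "real_norm \<nu>" and r_pos: "0 < r"
begin

lemma dist_to_finite_bounds:
  assumes "finite \<alpha>" "\<alpha> \<noteq> {}"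
  shows "a \<in> \<alpha> \<Longrightarrow> x \<in> cball a \<rho> \<Longrightarrow> (INF a\<in>\<alpha>. \<nu> (x - a)) \<le> \<nu> 1 * \<rho>"
    and "0 \<le> (INF a\<in>\<alpha>. \<nu> (x - a))"
    and "x \<notin> (\<Union>a\<in>\<alpha>. cball a \<rho>) \<Longrightarrow> \<nu> 1 * \<rho> \<le> (INF a\<in>\<alpha>. \<nu> (x - a))"
proof -
  have bdd: "bdd_below ((\<lambda>a. \<nu> (x - a)) ` \<alpha>)" using assms by simp
  note eq = real_norm_eq(1)[OF norm, of "x - _"] and pos = real_norm_eq(2)[OF norm]
  show "(INF a\<in>\<alpha>. \<nu> (x - a)) \<le> \<nu> 1 * \<rho>" if "a \<in> \<alpha>" "x \<in> cball a \<rho>"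
  proof -
    have "\<nu> (x - a) \<le> \<nu> 1 * \<rho>"
      unfolding eq[of a] using that pos by (intro mult_left_mono) (auto simp: dist_real_def)
    then show ?thesis using cINF_lower[OF bdd that(1)] by linarith
  qed
  show "0 \<le> (INF a\<in>\<alpha>. \<nu> (x - a))"
    using assms eq pos by (intro cINF_greatest) auto
  show "\<nu> 1 * \<rho> \<le> (INF a\<in>\<alpha>. \<nu> (x - a))" if "x \<notin> (\<Union>a\<in>\<alpha>. cball a \<rho>)"
  proof (intro cINF_greatest)
    fix a assume "a \<in> \<alpha>"
    then have "\<rho> \<le> \<bar>x - a\<bar>" using that by (force simp: dist_real_def)
    then show "\<nu> 1 * \<rho> \<le> \<nu> (x - a)" unfolding eq[of a] using pos by (intro mult_left_mono) auto
  qed (use assms in auto)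
qed

lemma cover_error_le:
  assumes "finite \<alpha>" "\<alpha> \<noteq> {}" "0 \<le> \<rho>" "E \<subseteq> (\<Union>a\<in>\<alpha>. cball a \<rho>)"
  shows "(\<integral>\<^sup>+ x. ennreal ((INF a\<in>\<alpha>. \<nu> (x - a)) powr r) \<partial>\<mu>) \<le> ennreal ((\<nu> 1 * \<rho>) powr r)"
proof -
  have cl: "closed (\<Union>a\<in>\<alpha>. cball a \<rho>)" using assms(1) by (intro closed_UN) auto
  then have "measure \<mu> (\<Union>a\<in>\<alpha>. cball a \<rho>) = 1" using assms(4) by (rule full)
  then have "AE x in \<mu>. x \<in> (\<Union>a\<in>\<alpha>. cball a \<rho>)" using prob_eq_1 closed_in_sets[OF cl] by blast
  then have "AE x in \<mu>. ennreal ((INF a\<in>\<alpha>. \<nu> (x - a)) powr r) \<le> ennreal ((\<nu> 1 * \<rho>) powr r)"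
  proof eventually_elim
    case (elim x)
    then obtain a where "a \<in> \<alpha>" "x \<in> cball a \<rho>" by blast
    then show ?case
      using dist_to_finite_bounds[OF assms(1,2)] r_pos by (intro ennreal_leI powr_mono2) auto
  qed
  then have "(\<integral>\<^sup>+ x. ennreal ((INF a\<in>\<alpha>. \<nu> (x - a)) powr r) \<partial>\<mu>)
      \<le> (\<integral>\<^sup>+ x. ennreal ((\<nu> 1 * \<rho>) powr r) \<partial>\<mu>)"
    by (rule nn_integral_mono_AE)
  then show ?thesis by (simp add: emeasure_space_1)
qed

text \<open>
  A net of mesh \<open>\<epsilon>\<close> is an admissible quantizer.
\<close>

lemma quant_error_upper:
  assumes "0 < \<epsilon>" "\<epsilon> \<le> 1" "C * (2 / \<epsilon>) powr h \<le> real n"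
  shows "quant_error \<nu> \<mu> r n \<le> (\<nu> 1 * \<epsilon>) powr r"
proof -
  obtain F where F: "finite F" "F \<noteq> {}" "real (card F) \<le> C * (2 / \<epsilon>) powr h"
    "E \<subseteq> (\<Union>a\<in>F. cball a \<epsilon>)"
    using finite_net[OF assms(1,2)] by blast
  have "real (card F) \<le> real n" using F(3) assms(3) by linarith
  then show ?thesis unfolding quant_error_def
    using F assms(1) cover_error_le[OF F(1,2) _ F(4)]
    by (intro enn2real_leI INF_lower2[of F]) auto
qed

text \<open>
  The radius is so small that \<open>n\<close> balls cover at most half of the mass; the other half is at
  distance at least \<open>\<rho>\<close> from any given \<open>n\<close> points.
\<close>

lemma quant_error_lower:
  assumes "1 \<le> n" "0 < \<rho>" "real n * (C * \<rho> powr h) \<le> 1 / 2"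
  shows "(\<nu> 1 * \<rho>) powr r / 2 \<le> quant_error \<nu> \<mu> r n"
proof -
  define err where
    "err \<alpha> = (\<integral>\<^sup>+ x. ennreal ((INF a\<in>\<alpha>. \<nu> (x - a)) powr r) \<partial>\<mu>)" for \<alpha>
  define V where "V = (INF \<alpha>\<in>{\<alpha>. \<alpha> \<noteq> {} \<and> finite \<alpha> \<and> card \<alpha> \<le> n}. err \<alpha>)"
  have each: "ennreal ((\<nu> 1 * \<rho>) powr r / 2) \<le> err \<alpha>"
    if \<alpha>: "\<alpha> \<noteq> {}" "finite \<alpha>" "card \<alpha> \<le> n" for \<alpha>
  proof -
    define A where "A = (\<Union>a\<in>\<alpha>. cball a \<rho>)"
    have A: "A \<in> sets \<mu>" unfolding A_def using \<alpha> by (intro closed_in_sets closed_UN) auto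
    then have coA: "- A \<in> sets \<mu>" using sets.compl_sets[OF A] unfolding space_UNIV Compl_eq_Diff_UNIV by blast
    have "measure \<mu> A \<le> (\<Sum>a\<in>\<alpha>. measure \<mu> (cball a \<rho>))"
      unfolding A_def by (intro finite_measure_subadditive_finite \<alpha> image_subsetI cball_in_sets)
    also have "\<dots> \<le> (\<Sum>a\<in>\<alpha>. C * \<rho> powr h)" using ball_upper[OF assms(2)] by (rule sum_mono)
    also have "\<dots> \<le> real n * (C * \<rho> powr h)" using \<alpha> C_pos by (simp add: mult_right_mono)
    finally have "measure \<mu> A \<le> 1 / 2" using assms(3) by simp
    then have half: "1 / 2 \<le> measure \<mu> (- A)"
      using prob_compl[OF A] unfolding space_UNIV Compl_eq_Diff_UNIV by linarith
    have "ennreal ((\<nu> 1 * \<rho>) powr r / 2) \<le> ennreal ((\<nu> 1 * \<rho>) powr r * measure \<mu> (- A))"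
      using mult_left_mono[OF half, of "(\<nu> 1 * \<rho>) powr r"] by (intro ennreal_leI) simp
    also have "\<dots> = ennreal ((\<nu> 1 * \<rho>) powr r) * emeasure \<mu> (- A)"
      by (simp add: emeasure_eq_measure ennreal_mult)
    also have "\<dots> = (\<integral>\<^sup>+ x. ennreal ((\<nu> 1 * \<rho>) powr r) * indicator (- A) x \<partial>\<mu>)"
      using coA by (simp add: nn_integral_cmult_indicator)
    also have "\<dots> \<le> err \<alpha>" unfolding err_def
    proof (intro nn_integral_mono)
      fix x
      show "ennreal ((\<nu> 1 * \<rho>) powr r) * indicator (- A) x
          \<le> ennreal ((INF a\<in>\<alpha>. \<nu> (x - a)) powr r)"
        using dist_to_finite_bounds(3)[OF \<alpha>(2,1), of x \<rho>] real_norm_eq(2)[OF norm] r_pos assms(2)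
        by (cases "x \<in> A") (auto simp: A_def intro!: ennreal_leI powr_mono2)
    qed
    finally show ?thesis .
  qed
  have "ennreal ((\<nu> 1 * \<rho>) powr r / 2) \<le> V" unfolding V_def using each by (intro INF_greatest) auto
  \<comment> \<open>The conversion to a real number sends infinity to zero, hence the need for finiteness.\<close>
  moreover have "V < \<infinity>"
  proof -
    obtain R where R: "0 < R" "E \<subseteq> cball 0 R"
      using bounded_support[unfolded bounded_pos] by (auto simp: subset_iff)
    then have "err {0} \<le> ennreal ((\<nu> 1 * R) powr r)"
      unfolding err_def by (intro cover_error_le) auto
    moreover have "V \<le> err {0}" unfolding V_def using assms(1) by (intro INF_lower) auto
    ultimately show ?thesis by (metis ennreal_less_top infinity_ennreal_def le_less_trans)
  qed
  ultimately have "enn2real (ennreal ((\<nu> 1 * \<rho>) powr r / 2)) \<le> enn2real V"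
    by (intro enn2real_mono) (auto simp: less_top)
  then show ?thesis unfolding quant_error_def V_def err_def by simp
qed

text \<open>
  Both bounds are used at the critical scale, that is at a constant multiple of
  \<open>n powr (- 1 / h)\<close>.
\<close>

lemma quant_error_asymptotics:
  obtains c c' where "0 < c" "0 < c'"
    "\<And>n. 1 \<le> n \<Longrightarrow> c * real n powr (- r / h) \<le> quant_error \<nu> \<mu> r n"
    "\<forall>\<^sub>F n in sequentially. quant_error \<nu> \<mu> r n \<le> c' * real n powr (- r / h)"
proof -
  note pos = real_norm_eq(2)[OF norm] h_pos C_pos
  define c where "c = (\<nu> 1 * (2 * C) powr (- 1 / h)) powr r / 2"
  define c' where "c' = (\<nu> 1 * (2 * C powr (1 / h))) powr r"
  have "c * real n powr (- r / h) \<le> quant_error \<nu> \<mu> r n" if "1 \<le> n" for n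
  proof -
    define \<rho> where "\<rho> = (2 * C * real n) powr (- 1 / h)"
    have \<rho>_eq: "\<rho> = (2 * C) powr (- 1 / h) * real n powr (- 1 / h)"
      unfolding \<rho>_def using pos by (intro powr_mult)
    have "0 < \<rho>" using pos that by (simp add: \<rho>_def)
    moreover have "\<rho> powr h = 1 / (2 * C * real n)"
      using pos that unfolding \<rho>_def powr_powr by (simp add: powr_minus_divide)
    then have "real n * (C * \<rho> powr h) \<le> 1 / 2" using pos that by simp
    ultimately have "(\<nu> 1 * \<rho>) powr r / 2 \<le> quant_error \<nu> \<mu> r n"
      by (intro quant_error_lower that) auto
    moreover have "(\<nu> 1 * \<rho>) powr r / 2 = c * real n powr (- r / h)"
      using pos that unfolding \<rho>_eq c_def by (simp add: powr_mult powr_powr mult.assoc)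
    ultimately show ?thesis by simp
  qed
  moreover have "\<forall>\<^sub>F n in sequentially. quant_error \<nu> \<mu> r n \<le> c' * real n powr (- r / h)"
  proof -
    have "\<forall>\<^sub>F n in sequentially. max 1 (C * 2 powr h) \<le> real n"
      using filterlim_real_sequentially unfolding filterlim_at_top by blast
    then show ?thesis
    proof eventually_elim
      case (elim n)
      define \<epsilon> where "\<epsilon> = 2 * C powr (1 / h) * real n powr (- 1 / h)"
      have n: "1 \<le> real n" "C * 2 powr h \<le> real n" using elim by auto
      have "0 < \<epsilon>" using pos n by (simp add: \<epsilon>_def)
      have \<epsilon>h: "\<epsilon> powr h = 2 powr h * (C * (1 / real n))"
      proof -
        have "\<epsilon> powr h = 2 powr h * C powr (1 / h * h) * real n powr (- 1 / h * h)"
          unfolding \<epsilon>_def by (simp only: powr_mult powr_powr)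
        then show ?thesis using pos n by (simp add: powr_minus_divide)
      qed
      have "\<epsilon> powr h \<le> 1 powr h"
        unfolding \<epsilon>h using n by (simp add: divide_le_eq_1_pos mult.commute)
      then have "\<epsilon> \<le> 1"
        using powr_less_mono2[OF h_pos, of 1 \<epsilon>] by (meson not_le zero_le_one)
      moreover have "C * (2 / \<epsilon>) powr h \<le> real n"
        using \<epsilon>h n pos \<open>0 < \<epsilon>\<close> by (simp add: powr_divide)
      ultimately have "quant_error \<nu> \<mu> r n \<le> (\<nu> 1 * \<epsilon>) powr r"
        using \<open>0 < \<epsilon>\<close> by (intro quant_error_upper)
      also have "\<dots> = c' * real n powr (- r / h)"
        using pos n unfolding \<epsilon>_def c'_def by (simp add: powr_mult powr_powr mult.assoc)
      finally show ?case .
    qed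
  qed
  moreover have "0 < c" "0 < c'" using pos by (simp_all add: c_def c'_def)
  ultimately show thesis using that by blast
qed

theorem quantization_dimension: "has_quantization_dimension \<nu> \<mu> r h"
  and lower_quantization_coefficient_pos: "0 < lower_quantization_coefficient \<nu> \<mu> r h"
proof -
  define V where "V n = quant_error \<nu> \<mu> r n" for n
  obtain c c' where c: "0 < c" "0 < c'"
    "\<And>n. 1 \<le> n \<Longrightarrow> c * real n powr (- r / h) \<le> V n"
    and V_le: "\<forall>\<^sub>F n in sequentially. V n \<le> c' * real n powr (- r / h)"
    using quant_error_asymptotics unfolding V_def by blast
  have V_pos: "0 < V n" if "1 \<le> n" for n
    using c(3)[OF that] mult_pos_pos[OF c(1), of "real n powr (- r / h)"] that by simp
  have ln_eq: "ln (b * real n powr (- r / h)) = ln b - r / h * ln (real n)"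
    if "0 < b" "1 \<le> n" for b n
    using that by (simp add: ln_mult_pos ln_powr)
  have lim: "(\<lambda>n. r / h - ln b / ln (real n)) \<longlonglongrightarrow> r / h" for b :: real
  proof -
    have "filterlim (\<lambda>n. ln (real n)) at_top sequentially"
      by (rule filterlim_compose[OF ln_at_top filterlim_real_sequentially])
    then have "(\<lambda>n. ln b / ln (real n)) \<longlonglongrightarrow> 0"
      by (intro tendsto_divide_0[OF tendsto_const] filterlim_at_top_imp_at_infinity)
    then show ?thesis using tendsto_diff[OF tendsto_const[of "r / h"]] by force
  qed
  have ratio: "(\<lambda>n. - ln (V n) / ln (real n)) \<longlonglongrightarrow> r / h"
  proof (rule tendsto_sandwich[OF _ _ lim[of c'] lim[of c]])
    show "\<forall>\<^sub>F n in sequentially. r / h - ln c' / ln (real n) \<le> - ln (V n) / ln (real n)"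
      using V_le eventually_ge_at_top[of 2]
    proof eventually_elim
      case (elim n)
      then have "ln (V n) \<le> ln (c' * real n powr (- r / h))" using V_pos[of n] by (intro ln_mono) auto
      then have "ln (V n) \<le> ln c' - r / h * ln (real n)" using ln_eq[of c' n] elim c by simp
      then have "(r / h * ln (real n) - ln c') / ln (real n) \<le> - ln (V n) / ln (real n)"
        using elim by (intro divide_right_mono) auto
      then show ?case using elim by (simp add: diff_divide_distrib)
    qed
    show "\<forall>\<^sub>F n in sequentially. - ln (V n) / ln (real n) \<le> r / h - ln c / ln (real n)"
      using eventually_ge_at_top[of 2]
    proof eventually_elim
      case (elim n)
      then have "ln (c * real n powr (- r / h)) \<le> ln (V n)" using c by (intro ln_mono) auto
      then have "ln c - r / h * ln (real n) \<le> ln (V n)" using ln_eq[of c n] elim c by simp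
      then have "- ln (V n) / ln (real n) \<le> (r / h * ln (real n) - ln c) / ln (real n)"
        using elim by (intro divide_right_mono) auto
      then show ?case using elim by (simp add: diff_divide_distrib)
    qed
  qed
  have "(\<lambda>n. r / (- ln (V n) / ln (real n))) \<longlonglongrightarrow> r / (r / h)"
    using h_pos r_pos by (intro tendsto_divide tendsto_const ratio) auto
  then show "has_quantization_dimension \<nu> \<mu> r h"
    unfolding has_quantization_dimension_def V_def using h_pos r_pos by simp
  have "ereal (c powr (h / r)) \<le> liminf (\<lambda>n. ereal (real n * V n powr (h / r)))"
  proof (rule Liminf_bounded)
    show "\<forall>\<^sub>F n in sequentially. ereal (c powr (h / r)) \<le> ereal (real n * V n powr (h / r))"
      using eventually_ge_at_top[of 1]
    proof eventually_elim
      case (elim n)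
      have "(c * real n powr (- r / h)) powr (h / r) = c powr (h / r) * real n powr (- 1)"
        using c(1) h_pos r_pos by (subst powr_mult) (simp_all only: powr_powr, simp_all)
      then have "c powr (h / r) = real n * (c * real n powr (- r / h)) powr (h / r)"
        using elim by (simp add: powr_minus_divide)
      also have "\<dots> \<le> real n * V n powr (h / r)"
        using elim c(1) c(3)[of n] h_pos r_pos by (intro mult_left_mono powr_mono2) auto
      finally show ?case by simp
    qed
  qed
  moreover have "0 < ereal (c powr (h / r))" using c(1) by simp
  ultimately show "0 < lower_quantization_coefficient \<nu> \<mu> r h"
    unfolding lower_quantization_coefficient_def V_def by (rule less_le_trans[rotated])
qed

end

end

section \<open>Branch inverses and bounded distortion\<close>

lemma finite_disjoint_compact_gap:
  fixes A :: "nat \<Rightarrow> real set"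
  assumes "finite I" "disjoint_family_on A I" "\<And>i. i \<in> I \<Longrightarrow> compact (A i)"
  obtains \<delta> where "0 < \<delta>"
    "\<And>i j x y. i \<in> I \<Longrightarrow> j \<in> I \<Longrightarrow> i \<noteq> j \<Longrightarrow> x \<in> A i \<Longrightarrow> y \<in> A j \<Longrightarrow> \<delta> \<le> \<bar>x - y\<bar>"
proof -
  define P where "P = {p \<in> I \<times> I. fst p \<noteq> snd p}"
  have fin: "finite P" unfolding P_def using assms(1) by simp
  have "\<forall>p\<in>P. \<exists>d>0. \<forall>x\<in>A (fst p). \<forall>y\<in>A (snd p). d \<le> dist x y"
    using assms by (auto simp: P_def disjoint_family_on_def compact_imp_closed intro!: separate_compact_closed)
  then obtain d where d: "\<And>p. p \<in> P \<Longrightarrow> 0 < d p"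
    "\<And>p x y. p \<in> P \<Longrightarrow> x \<in> A (fst p) \<Longrightarrow> y \<in> A (snd p) \<Longrightarrow> d p \<le> dist x y"
    by metis
  define \<delta> where "\<delta> = Min (insert 1 (d ` P))"
  have "0 < \<delta>" unfolding \<delta>_def using fin d(1) by simp
  moreover have "\<delta> \<le> \<bar>x - y\<bar>" if "i \<in> I" "j \<in> I" "i \<noteq> j" "x \<in> A i" "y \<in> A j" for i j x y
  proof -
    have p: "(i, j) \<in> P" using that by (simp add: P_def)
    then have "\<delta> \<le> d (i, j)" unfolding \<delta>_def using fin by (intro Min_le) auto
    with d(2)[OF p, of x y] that show ?thesis by (simp add: dist_real_def)
  qed
  ultimately show thesis using that by blast
qed

locale cookie_cutter_map =
  fixes f :: "real \<Rightarrow> real" and J :: "nat \<Rightarrow> real set" and N :: nat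
  assumes cookie_cutter: "cookie_cutter f J N"
begin

abbreviation \<phi> :: "nat list \<Rightarrow> real \<Rightarrow> real" where "\<phi> \<equiv> word_map f J"

definition slope :: "nat list \<Rightarrow> real \<Rightarrow> real" where
  "slope \<sigma> x = vector_derivative (\<phi> \<sigma>) (at x within {0..1})"

lemmas conditions = cookie_cutter[unfolded cookie_cutter_def]

lemmas two_le_N = conditions[THEN conjunct1]
  and branch_intervals = conditions[THEN conjunct2, THEN conjunct1]
  and disjoint_branches = conditions[THEN conjunct2, THEN conjunct2, THEN conjunct1]
  and bij_branches = conditions[THEN conjunct2, THEN conjunct2, THEN conjunct2, THEN conjunct1]
  and derivative_conditions = conditions[THEN conjunct2, THEN conjunct2, THEN conjunct2, THEN conjunct2]

lemmas differentiable_nearby = derivative_conditions[THEN conjunct1]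
  and holder_derivative = derivative_conditions[THEN conjunct2, THEN conjunct1]
  and expanding = derivative_conditions[THEN conjunct2, THEN conjunct2, THEN conjunct1]
  and bounded_derivative = derivative_conditions[THEN conjunct2, THEN conjunct2, THEN conjunct2]

lemma branch_compact: "j \<in> {1..N} \<Longrightarrow> compact (J j)"
  using branch_intervals compact_Icc by metis

lemma branch_subset: "j \<in> {1..N} \<Longrightarrow> J j \<subseteq> {0..1}"
  using branch_intervals by blast

lemma bij_branch: "j \<in> {1..N} \<Longrightarrow> bij_betw f (J j) {0..1}"
  using bij_branches by blast

lemma f_has_derivative:
  assumes "j \<in> {1..N}" "x \<in> J j"
  shows "(f has_real_derivative deriv f x) (at x)"
proof -
  obtain U where U: "open U" "(\<Union>j\<in>{1..N}. J j) \<subseteq> U" "f differentiable_on U"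
    using differentiable_nearby by blast
  then have "f differentiable (at x)"
    using assms differentiable_on_eq_differentiable_at by blast
  then show ?thesis by (simp add: DERIV_deriv_iff_real_differentiable)
qed

lemma derivative_bounds:
  obtains b B where "1 < b" "b \<le> B"
    "\<And>j x. j \<in> {1..N} \<Longrightarrow> x \<in> J j \<Longrightarrow> b \<le> \<bar>deriv f x\<bar> \<and> \<bar>deriv f x\<bar> \<le> B"
proof -
  define S where "S = (\<Union>j\<in>{1..N}. J j)"
  define b where "b = (INF x\<in>S. \<bar>deriv f x\<bar>)"
  have "1 < b" "bdd_above ((\<lambda>x. \<bar>deriv f x\<bar>) ` S)"
    using expanding bounded_derivative unfolding S_def b_def .
  then obtain B where B: "\<And>x. x \<in> S \<Longrightarrow> \<bar>deriv f x\<bar> \<le> B" by (auto simp: bdd_above_def)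
  have bdd: "bdd_below ((\<lambda>x. \<bar>deriv f x\<bar>) ` S)" by (rule bdd_belowI[of _ 0]) auto
  have "b \<le> \<bar>deriv f x\<bar>" if "x \<in> S" for x unfolding b_def by (rule cINF_lower[OF bdd that])
  moreover have "\<bar>deriv f x\<bar> \<le> max b B" if "x \<in> S" for x using B[OF that] by simp
  ultimately show thesis
    using UN_I[of _ "{1..N}" _ J] unfolding S_def
    by (intro that[of b "max b B"] \<open>1 < b\<close>) (simp, metis)
qed

lemma branch_inverse:
  assumes "j \<in> {1..N}" "y \<in> {0..1}"
  shows "inv_into (J j) f y \<in> J j" "f (inv_into (J j) f y) = y"
proof -
  have im: "f ` J j = {0..1}" using bij_branch[OF assms(1)] by (simp add: bij_betw_def)
  then show "inv_into (J j) f y \<in> J j" "f (inv_into (J j) f y) = y"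
    using assms(2) by (auto intro: inv_into_into f_inv_into_f)
qed

text \<open>
  The derivative is one-sided at the end points of \<open>{0..1}\<close>, where the branch inverse has arbitrary
  values outside, so the difference quotient of the inverse is computed directly as the
  reciprocal of the difference quotient of \<open>f\<close> at a point that tends to the limit along the branch.
\<close>

lemma branch_inverse_has_derivative:
  assumes j: "j \<in> {1..N}" and y: "y \<in> {0..1}"
  shows "(inv_into (J j) f has_real_derivative 1 / deriv f (inv_into (J j) f y)) (at y within {0..1})"
proof -
  define g where "g = inv_into (J j) f"
  define d where "d = deriv f (g y)"
  obtain b B where b: "1 < b" "\<And>j x. j \<in> {1..N} \<Longrightarrow> x \<in> J j \<Longrightarrow> b \<le> \<bar>deriv f x\<bar> \<and> \<bar>deriv f x\<bar> \<le> B"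
    using derivative_bounds by metis
  have g: "g z \<in> J j" "f (g z) = z" if "z \<in> {0..1}" for z
    using branch_inverse[OF j that] by (auto simp: g_def)
  have "d \<noteq> 0" using b(2)[OF j g(1)[OF y]] b(1) by (auto simp: d_def)
  have cont: "continuous_on {0..1} g"
  proof -
    have "continuous_on (J j) f"
      using f_has_derivative[OF j] by (auto intro!: continuous_at_imp_continuous_on DERIV_isCont)
    moreover have "\<forall>x\<in>J j. g (f x) = x"
      using bij_branch[OF j] by (auto simp: g_def bij_betw_def inv_into_f_f)
    ultimately have "continuous_on (f ` J j) g"
      using branch_compact[OF j] continuous_on_inv by blast
    then show ?thesis using bij_branch[OF j] by (simp add: bij_betw_def)
  qed
  have ev: "\<forall>\<^sub>F z in at y within {0..1}. z \<in> {0..1} \<and> z \<noteq> y"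
    by (auto simp: eventually_at_filter)
  have "filterlim g (at (g y)) (at y within {0..1})"
    unfolding filterlim_at
  proof
    show "\<forall>\<^sub>F z in at y within {0..1}. g z \<in> UNIV \<and> g z \<noteq> g y"
      using ev by eventually_elim (metis g(2) y UNIV_I)
    show "(g \<longlongrightarrow> g y) (at y within {0..1})" using cont y by (simp add: continuous_on_def)
  qed
  moreover have "((\<lambda>u. (f u - f (g y)) / (u - g y)) \<longlongrightarrow> d) (at (g y))"
    using f_has_derivative[OF j g(1)[OF y]] by (simp add: has_field_derivative_iff d_def)
  ultimately have "((\<lambda>z. (f (g z) - f (g y)) / (g z - g y)) \<longlongrightarrow> d) (at y within {0..1})"
    by (rule filterlim_compose[rotated])
  then have "((\<lambda>z. inverse ((f (g z) - f (g y)) / (g z - g y))) \<longlongrightarrow> inverse d) (at y within {0..1})"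
    using \<open>d \<noteq> 0\<close> by (rule tendsto_inverse)
  moreover have "\<forall>\<^sub>F z in at y within {0..1}.
      inverse ((f (g z) - f (g y)) / (g z - g y)) = (g z - g y) / (z - y)"
    using ev by eventually_elim (simp add: g(2) g(2)[OF y])
  ultimately have "((\<lambda>z. (g z - g y) / (z - y)) \<longlongrightarrow> inverse d) (at y within {0..1})"
    by (rule Lim_transform_eventually)
  then have "(g has_real_derivative inverse d) (at y within {0..1})"
    by (simp add: has_field_derivative_iff)
  then show ?thesis by (simp add: g_def d_def inverse_eq_divide)
qed

lemma word_map_range: "set \<sigma> \<subseteq> {1..N} \<Longrightarrow> x \<in> {0..1} \<Longrightarrow> \<phi> \<sigma> x \<in> {0..1}"
proof (induction \<sigma>)
  case (Cons j \<sigma>)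
  then have j: "j \<in> {1..N}" and "\<phi> \<sigma> x \<in> {0..1}" by simp_all
  with branch_inverse(1)[OF this] branch_subset[OF j] show ?case by auto
qed simp

lemma word_map_Cons_range:
  "set (j # \<sigma>) \<subseteq> {1..N} \<Longrightarrow> x \<in> {0..1} \<Longrightarrow> \<phi> (j # \<sigma>) x \<in> J j"
  using branch_inverse(1)[of j "\<phi> \<sigma> x"] word_map_range[of \<sigma> x] by simp

lemma slope_Nil: "x \<in> {0..1} \<Longrightarrow> slope [] x = 1"
  unfolding slope_def
  by (rule vector_derivative_within_closed_interval)
    (auto simp flip: has_real_derivative_iff_has_vector_derivative intro!: derivative_eq_intros simp: id_def)

lemma word_map_has_derivative:
  "set \<sigma> \<subseteq> {1..N} \<Longrightarrow> x \<in> {0..1} \<Longrightarrow> (\<phi> \<sigma> has_real_derivative slope \<sigma> x) (at x within {0..1})"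
  and slope_Cons:
  "set (j # \<sigma>) \<subseteq> {1..N} \<Longrightarrow> x \<in> {0..1} \<Longrightarrow>
    slope (j # \<sigma>) x = slope \<sigma> x / deriv f (\<phi> (j # \<sigma>) x)"
proof -
  have step: "(\<phi> (j # \<sigma>) has_real_derivative slope \<sigma> x / deriv f (\<phi> (j # \<sigma>) x)) (at x within {0..1})"
    if "(\<phi> \<sigma> has_real_derivative slope \<sigma> x) (at x within {0..1})"
      "set (j # \<sigma>) \<subseteq> {1..N}" "x \<in> {0..1}" for j \<sigma> x
  proof -
    have "(inv_into (J j) f has_real_derivative 1 / deriv f (inv_into (J j) f (\<phi> \<sigma> x)))
        (at (\<phi> \<sigma> x) within \<phi> \<sigma> ` {0..1})"
      by (rule DERIV_subset[OF branch_inverse_has_derivative])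
        (use that word_map_range[of \<sigma>] in \<open>auto simp del: atLeastAtMost_iff\<close>)
    from DERIV_image_chain[OF this that(1)] show ?thesis by simp
  qed
  have eq: "slope (j # \<sigma>) x = slope \<sigma> x / deriv f (\<phi> (j # \<sigma>) x)"
    if "(\<phi> \<sigma> has_real_derivative slope \<sigma> x) (at x within {0..1})"
      "set (j # \<sigma>) \<subseteq> {1..N}" "x \<in> {0..1}" for j \<sigma> x
    unfolding slope_def[of "j # \<sigma>"] using step[OF that] that(3)
    by (intro vector_derivative_within_closed_interval)
      (auto simp flip: has_real_derivative_iff_has_vector_derivative)
  show *: "(\<phi> \<sigma> has_real_derivative slope \<sigma> x) (at x within {0..1})"
    if "set \<sigma> \<subseteq> {1..N}" "x \<in> {0..1}" for \<sigma> x
    using that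
  proof (induction \<sigma>)
    case Nil
    then show ?case
      using slope_Nil[of x] by (auto intro!: derivative_eq_intros simp: id_def)
  next
    case (Cons j \<sigma>)
    then have "(\<phi> \<sigma> has_real_derivative slope \<sigma> x) (at x within {0..1})" by simp
    from step[OF this Cons.prems] eq[OF this Cons.prems] show ?case by metis
  qed
  show "slope (j # \<sigma>) x = slope \<sigma> x / deriv f (\<phi> (j # \<sigma>) x)"
    if "set (j # \<sigma>) \<subseteq> {1..N}" "x \<in> {0..1}"
    using eq[OF *[of \<sigma> x]] that by simp
qed

lemma word_map_mean_value:
  assumes "set \<sigma> \<subseteq> {1..N}" "x \<in> {0..1}" "y \<in> {0..1}"
  obtains \<xi> where "\<xi> \<in> {0..1}" "\<bar>\<phi> \<sigma> x - \<phi> \<sigma> y\<bar> = \<bar>slope \<sigma> \<xi>\<bar> * \<bar>x - y\<bar>"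
proof -
  have aux: "\<exists>\<xi>\<in>{0..1}. \<bar>\<phi> \<sigma> y - \<phi> \<sigma> x\<bar> = \<bar>slope \<sigma> \<xi>\<bar> * \<bar>y - x\<bar>"
    if "x < y" "x \<in> {0..1}" "y \<in> {0..1}" for x y
  proof -
    have "(\<phi> \<sigma> has_derivative (\<lambda>h. slope \<sigma> u * h)) (at u within {x..y})" if "x \<le> u" "u \<le> y" for u
      using word_map_has_derivative[OF assms(1), of u] that \<open>x \<in> {0..1}\<close> \<open>y \<in> {0..1}\<close>
      unfolding has_field_derivative_def by (auto intro: has_derivative_subset)
    from mvt_simple[OF that(1) this] obtain \<xi> where "\<xi> \<in> {x<..<y}"
      "\<phi> \<sigma> y - \<phi> \<sigma> x = slope \<sigma> \<xi> * (y - x)" by blast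
    then show ?thesis using that by (intro bexI[of _ \<xi>]) (auto simp: abs_mult)
  qed
  consider "x < y" | "y < x" | "x = y" by linarith
  then show thesis
  proof cases
    case 1
    then show thesis using aux[of x y] assms that by (metis abs_minus_commute)
  next
    case 2
    then show thesis using aux[of y x] assms that by metis
  next
    case 3
    then show thesis using that[of x] assms by simp
  qed
qed

lemma slope_bounds:
  assumes "1 < b"
    and "\<And>j x. j \<in> {1..N} \<Longrightarrow> x \<in> J j \<Longrightarrow> b \<le> \<bar>deriv f x\<bar> \<and> \<bar>deriv f x\<bar> \<le> B"
    and "set \<sigma> \<subseteq> {1..N}" "x \<in> {0..1}"
  shows "(1 / B) ^ length \<sigma> \<le> \<bar>slope \<sigma> x\<bar> \<and> \<bar>slope \<sigma> x\<bar> \<le> (1 / b) ^ length \<sigma>"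
  using assms(3)
proof (induction \<sigma>)
  case Nil
  then show ?case using slope_Nil[OF assms(4)] by simp
next
  case (Cons j \<sigma>)
  then have IH: "(1 / B) ^ length \<sigma> \<le> \<bar>slope \<sigma> x\<bar>" "\<bar>slope \<sigma> x\<bar> \<le> (1 / b) ^ length \<sigma>"
    and "j \<in> {1..N}" by auto
  define d where "d = \<bar>deriv f (\<phi> (j # \<sigma>) x)\<bar>"
  have d: "b \<le> d" "d \<le> B"
    using assms(2)[OF \<open>j \<in> {1..N}\<close> word_map_Cons_range[OF Cons.prems assms(4)]] by (auto simp: d_def)
  have "\<bar>slope (j # \<sigma>) x\<bar> = 1 / d * \<bar>slope \<sigma> x\<bar>"
    using slope_Cons[OF Cons.prems assms(4)] by (simp add: d_def abs_divide)
  moreover have "1 / B * (1 / B) ^ length \<sigma> \<le> 1 / d * \<bar>slope \<sigma> x\<bar>"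
    using IH(1) d assms(1) by (intro mult_mono) (auto simp: frac_le)
  moreover have "1 / d * \<bar>slope \<sigma> x\<bar> \<le> 1 / b * (1 / b) ^ length \<sigma>"
    using IH(2) d assms(1) by (intro mult_mono) (auto simp: frac_le)
  ultimately show ?case by simp
qed

text \<open>
  The images of two points under the tails of a word are exponentially close.  Their derivatives
  therefore differ, by the Hoelder condition, by relative errors that form a geometric series with
  ratio \<open>q = (1 / b) powr \<gamma>\<close>, and the product of the corresponding factors stays below
  \<open>exp (c / (1 - q))\<close>.
\<close>

lemma bounded_distortion:
  obtains K where "1 \<le> K"
    "\<And>\<sigma> x y. set \<sigma> \<subseteq> {1..N} \<Longrightarrow> x \<in> {0..1} \<Longrightarrow> y \<in> {0..1} \<Longrightarrow> \<bar>slope \<sigma> x\<bar> \<le> K * \<bar>slope \<sigma> y\<bar>"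
proof -
  obtain b B where b: "1 < b"
    "\<And>j x. j \<in> {1..N} \<Longrightarrow> x \<in> J j \<Longrightarrow> b \<le> \<bar>deriv f x\<bar> \<and> \<bar>deriv f x\<bar> \<le> B"
    using derivative_bounds by metis
  obtain c \<gamma> where c: "0 < c" and \<gamma>: "0 < \<gamma>" and
    holder: "\<And>j x y. j \<in> {1..N} \<Longrightarrow> x \<in> J j \<Longrightarrow> y \<in> J j \<Longrightarrow>
      \<bar>deriv f x - deriv f y\<bar> \<le> c * \<bar>x - y\<bar> powr \<gamma>"
    using holder_derivative by metis
  define q where "q = (1 / b) powr \<gamma>"
  have q: "0 < q" "q < 1" using b(1) \<gamma> powr_less_mono2[of \<gamma> "1 / b" 1]
    by (auto simp: q_def)
  define G where "G n = c * (\<Sum>i<n. q ^ i)" for n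
  have dist: "\<bar>slope \<sigma> x\<bar> \<le> exp (G (length \<sigma>)) * \<bar>slope \<sigma> y\<bar>"
    if "set \<sigma> \<subseteq> {1..N}" and xy: "x \<in> {0..1}" "y \<in> {0..1}" for \<sigma> x y
    using that(1)
  proof (induction \<sigma>)
    case Nil
    then show ?case using slope_Nil xy by (simp add: G_def)
  next
    case (Cons j \<sigma>)
    then have IH: "\<bar>slope \<sigma> x\<bar> \<le> exp (G (length \<sigma>)) * \<bar>slope \<sigma> y\<bar>" and j: "j \<in> {1..N}" by auto
    define u v where "u = \<phi> (j # \<sigma>) x" and "v = \<phi> (j # \<sigma>) y"
    have uv: "u \<in> J j" "v \<in> J j"
      using word_map_Cons_range[OF Cons.prems] xy by (auto simp: u_def v_def)
    have d: "b \<le> \<bar>deriv f u\<bar>" "b \<le> \<bar>deriv f v\<bar>" using b(2)[OF j] uv by auto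
    obtain \<xi> where \<xi>: "\<xi> \<in> {0..1}" "\<bar>u - v\<bar> = \<bar>slope (j # \<sigma>) \<xi>\<bar> * \<bar>x - y\<bar>"
      using word_map_mean_value[OF Cons.prems xy] unfolding u_def v_def by blast
    have "\<bar>slope (j # \<sigma>) \<xi>\<bar> \<le> (1 / b) ^ length (j # \<sigma>)"
      using slope_bounds[OF b(1) _ Cons.prems \<xi>(1), of B] b(2) by blast
    then have "\<bar>u - v\<bar> \<le> (1 / b) ^ length (j # \<sigma>) * 1"
      unfolding \<xi>(2) using xy b(1) by (intro mult_mono) auto
    also have "\<dots> \<le> (1 / b) ^ length \<sigma>"
      using power_decreasing[of "length \<sigma>" "length (j # \<sigma>)" "1 / b"] b(1) by simp
    finally have "\<bar>u - v\<bar> powr \<gamma> \<le> ((1 / b) ^ length \<sigma>) powr \<gamma>"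
      using \<gamma> by (intro powr_mono2) auto
    also have "\<dots> = q ^ length \<sigma>"
      using b(1) by (simp add: q_def powr_realpow[symmetric] powr_powr mult.commute)
    finally have "\<bar>deriv f v - deriv f u\<bar> \<le> c * q ^ length \<sigma>"
      using holder[OF j uv(2,1)] c by (smt (verit) abs_minus_commute mult_left_mono)
    moreover have "c * q ^ length \<sigma> \<le> c * q ^ length \<sigma> * \<bar>deriv f u\<bar>"
      using mult_left_mono[of 1 "\<bar>deriv f u\<bar>" "c * q ^ length \<sigma>"] d b(1) c q by simp
    ultimately have "\<bar>deriv f v\<bar> \<le> (1 + c * q ^ length \<sigma>) * \<bar>deriv f u\<bar>"
      by (simp add: algebra_simps)
    also have "\<dots> \<le> exp (c * q ^ length \<sigma>) * \<bar>deriv f u\<bar>"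
      by (intro mult_right_mono) auto
    finally have r: "1 / \<bar>deriv f u\<bar> \<le> exp (c * q ^ length \<sigma>) * (1 / \<bar>deriv f v\<bar>)"
      using d b(1) by (simp add: field_simps)
    have s: "\<bar>slope (j # \<sigma>) x\<bar> = 1 / \<bar>deriv f u\<bar> * \<bar>slope \<sigma> x\<bar>"
      "\<bar>slope (j # \<sigma>) y\<bar> = 1 / \<bar>deriv f v\<bar> * \<bar>slope \<sigma> y\<bar>"
      using slope_Cons[OF Cons.prems] xy by (auto simp: u_def v_def abs_divide)
    have "\<bar>slope (j # \<sigma>) x\<bar>
        \<le> exp (c * q ^ length \<sigma>) * (1 / \<bar>deriv f v\<bar>) * (exp (G (length \<sigma>)) * \<bar>slope \<sigma> y\<bar>)"
      unfolding s(1) using r IH by (intro mult_mono) auto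
    also have "\<dots> = exp (G (length (j # \<sigma>))) * \<bar>slope (j # \<sigma>) y\<bar>"
      unfolding s(2) by (simp add: G_def exp_add algebra_simps)
    finally show ?case .
  qed
  define K where "K = exp (c / (1 - q))"
  have "G n \<le> c / (1 - q)" for n
  proof -
    have "(\<Sum>i<n. q ^ i) \<le> 1 / (1 - q)"
      using q by (simp add: sum_gp_strict divide_right_mono)
    from mult_left_mono[OF this, of c] show ?thesis using c by (simp add: G_def)
  qed
  then have le: "exp (G n) \<le> K" for n by (simp add: K_def)
  have "1 \<le> K" using c q by (simp add: K_def)
  moreover have "\<bar>slope \<sigma> x\<bar> \<le> K * \<bar>slope \<sigma> y\<bar>"
    if "set \<sigma> \<subseteq> {1..N}" "x \<in> {0..1}" "y \<in> {0..1}" for \<sigma> x y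
    using dist[OF that] mult_right_mono[OF le, of "\<bar>slope \<sigma> y\<bar>" "length \<sigma>"] by linarith
  ultimately show thesis using that by blast
qed

end

text \<open>
  The constants are fixed here once and for all, so that the estimates of the sequel can refer to
  them by name.  By the mean value theorem, bounded distortion turns the norm of the derivative into
  a two-sided Lipschitz ratio; all later distance estimates use it in this form.
\<close>

locale cookie_cutter_geometry = cookie_cutter_map f J N
  for f :: "real \<Rightarrow> real" and J :: "nat \<Rightarrow> real set" and N :: nat +
  fixes K \<eta> \<theta> \<delta> :: real
  assumes K_ge_1: "1 \<le> K" and \<eta>_gt_0: "0 < \<eta>" and \<theta>_lt_1: "\<theta> < 1" and \<delta>_pos: "0 < \<delta>"
    and norm_bounds: "set \<sigma> \<subseteq> {1..N} \<Longrightarrow>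
      \<eta> ^ length \<sigma> \<le> word_deriv_norm f J \<sigma> \<and> word_deriv_norm f J \<sigma> \<le> \<theta> ^ length \<sigma>"
    and lipschitz: "set \<sigma> \<subseteq> {1..N} \<Longrightarrow> x \<in> {0..1} \<Longrightarrow> y \<in> {0..1} \<Longrightarrow>
      \<bar>word_map f J \<sigma> x - word_map f J \<sigma> y\<bar> \<le> word_deriv_norm f J \<sigma> * \<bar>x - y\<bar>"
    and inverse_lipschitz: "set \<sigma> \<subseteq> {1..N} \<Longrightarrow> x \<in> {0..1} \<Longrightarrow> y \<in> {0..1} \<Longrightarrow>
      word_deriv_norm f J \<sigma> * \<bar>x - y\<bar> \<le> K * \<bar>word_map f J \<sigma> x - word_map f J \<sigma> y\<bar>"
    and branch_gap: "i \<in> {1..N} \<Longrightarrow> j \<in> {1..N} \<Longrightarrow> i \<noteq> j \<Longrightarrow> x \<in> J i \<Longrightarrow> y \<in> J j \<Longrightarrow>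
      \<delta> \<le> \<bar>x - y\<bar>"

lemma (in cookie_cutter_map) geometry_exists:
  obtains K \<eta> \<theta> \<delta> where "cookie_cutter_geometry f J N K \<eta> \<theta> \<delta>"
proof -
  obtain b B where b: "1 < b" "b \<le> B"
    "\<And>j x. j \<in> {1..N} \<Longrightarrow> x \<in> J j \<Longrightarrow> b \<le> \<bar>deriv f x\<bar> \<and> \<bar>deriv f x\<bar> \<le> B"
    using derivative_bounds by metis
  obtain K where K: "1 \<le> K"
    "\<And>\<sigma> x y. set \<sigma> \<subseteq> {1..N} \<Longrightarrow> x \<in> {0..1} \<Longrightarrow> y \<in> {0..1} \<Longrightarrow> \<bar>slope \<sigma> x\<bar> \<le> K * \<bar>slope \<sigma> y\<bar>"
    using bounded_distortion by metis
  obtain \<delta> where \<delta>: "0 < \<delta>"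
    "\<And>i j x y. i \<in> {1..N} \<Longrightarrow> j \<in> {1..N} \<Longrightarrow> i \<noteq> j \<Longrightarrow> x \<in> J i \<Longrightarrow> y \<in> J j \<Longrightarrow> \<delta> \<le> \<bar>x - y\<bar>"
    by (rule finite_disjoint_compact_gap[OF _ disjoint_branches branch_compact]) auto
  have norm_eq: "word_deriv_norm f J \<sigma> = (SUP x\<in>{0..1}. \<bar>slope \<sigma> x\<bar>)" for \<sigma>
    by (simp add: word_deriv_norm_def slope_def)
  have sb: "(1 / B) ^ length \<sigma> \<le> \<bar>slope \<sigma> x\<bar>" "\<bar>slope \<sigma> x\<bar> \<le> (1 / b) ^ length \<sigma>"
    if "set \<sigma> \<subseteq> {1..N}" "x \<in> {0..1}" for \<sigma> x
    using slope_bounds[OF b(1,3) that] by auto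
  have ge: "\<bar>slope \<sigma> x\<bar> \<le> word_deriv_norm f J \<sigma>" if "set \<sigma> \<subseteq> {1..N}" "x \<in> {0..1}" for \<sigma> x
    unfolding norm_eq using sb(2)[OF that(1)] that(2)
    by (intro cSUP_upper bdd_aboveI[of _ "(1 / b) ^ length \<sigma>"]) auto
  have le: "word_deriv_norm f J \<sigma> \<le> z"
    if "\<And>x. x \<in> {0..1} \<Longrightarrow> \<bar>slope \<sigma> x\<bar> \<le> z" for \<sigma> z
    unfolding norm_eq using that by (intro cSUP_least) auto
  have "cookie_cutter_geometry f J N K (1 / B) (1 / b) \<delta>"
  proof (unfold_locales, goal_cases)
    case (5 \<sigma>)
    have "(0 :: real) \<in> {0..1}" by simp
    from sb(1)[OF 5 this] ge[OF 5 this] le[OF sb(2)[OF 5]] show ?case by linarith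
  next
    case (6 \<sigma> x y)
    then obtain \<xi> where \<xi>: "\<xi> \<in> {0..1}" "\<bar>\<phi> \<sigma> x - \<phi> \<sigma> y\<bar> = \<bar>slope \<sigma> \<xi>\<bar> * \<bar>x - y\<bar>"
      using word_map_mean_value by blast
    show ?case unfolding \<xi>(2) by (intro mult_right_mono ge 6 \<xi>) auto
  next
    case (7 \<sigma> x y)
    then obtain \<xi> where \<xi>: "\<xi> \<in> {0..1}" "\<bar>\<phi> \<sigma> x - \<phi> \<sigma> y\<bar> = \<bar>slope \<sigma> \<xi>\<bar> * \<bar>x - y\<bar>"
      using word_map_mean_value by blast
    have "word_deriv_norm f J \<sigma> \<le> K * \<bar>slope \<sigma> \<xi>\<bar>" using K(2)[OF 7(1) _ \<xi>(1)] by (rule le)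
    from mult_right_mono[OF this, of "\<bar>x - y\<bar>"] show ?case unfolding \<xi>(2) by (simp add: mult.assoc)
  qed (use K(1) \<delta> b in auto)
  then show thesis by (rule that)
qed

section \<open>Geometry of the coding map\<close>

lemma word_map_append: "word_map f J (\<sigma> @ \<tau>) x = word_map f J \<sigma> (word_map f J \<tau> x)"
  by (induction \<sigma>) auto

lemma word_interval_append: "word_interval f J (\<sigma> @ \<tau>) = word_map f J \<sigma> ` word_interval f J \<tau>"
  by (simp add: word_interval_def image_image word_map_append)

lemma trunc_Suc: "trunc (Suc k) \<tau> = trunc k \<tau> @ [\<tau> k]"
  by (simp add: trunc_def)

lemma length_trunc [simp]: "length (trunc k \<tau>) = k"
  by (simp add: trunc_def)

lemma set_trunc: "\<tau> \<in> inf_words N \<Longrightarrow> set (trunc k \<tau>) \<subseteq> {1..N}"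
  by (auto simp: trunc_def inf_words_def)

text \<open>
  Each prefix condition restricts finitely many coordinates, and points are closed in the discrete
  space of letters.
\<close>

lemma trunc_measurable: "trunc k \<in> borel \<rightarrow>\<^sub>M count_space UNIV"
proof (subst measurable_count_space_eq2_countable, intro conjI ballI)
  fix \<sigma> :: "nat list"
  have coord: "closed {\<tau> :: nat \<Rightarrow> nat. \<tau> i = c}" for i c
    by (intro closed_Collect_eq continuous_on_product_coordinates continuous_on_const)
  have "trunc k \<tau> = \<sigma> \<longleftrightarrow> length \<sigma> = k \<and> (\<forall>i\<in>{..<k}. \<tau> i = \<sigma> ! i)" for \<tau>
    unfolding list_eq_iff_nth_eq trunc_def by auto
  then have "trunc k -` {\<sigma>} = (if length \<sigma> = k then (\<Inter>i\<in>{..<k}. {\<tau>. \<tau> i = \<sigma> ! i}) else {})"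
    by auto
  moreover have "closed (\<Inter>i\<in>{..<k}. {\<tau> :: nat \<Rightarrow> nat. \<tau> i = \<sigma> ! i})"
    by (intro closed_INT ballI coord)
  ultimately show "trunc k -` {\<sigma>} \<inter> space borel \<in> sets borel"
    by (simp add: borel_closed)
qed auto

context cookie_cutter_geometry
begin

abbreviation M :: "nat list \<Rightarrow> real" where "M \<equiv> word_deriv_norm f J"

abbreviation I :: "nat list \<Rightarrow> real set" where "I \<equiv> word_interval f J"

text \<open>
  Both inequalities for concatenated words come from following the two points \<open>0\<close> and \<open>1\<close> through
  \<open>\<phi> \<tau>\<close> and then through \<open>\<phi> \<sigma>\<close>; each inequality costs at most two factors \<open>K\<close>.
\<close>

sublocale weight: quasi_multiplicative_weight N M "K\<^sup>2" \<eta> \<theta>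
proof
  show "2 \<le> N" by (rule two_le_N)
  show "1 \<le> K\<^sup>2" using K_ge_1 by simp
  show "0 < \<eta>" "\<theta> < 1" by (rule \<eta>_gt_0 \<theta>_lt_1)+
  show "\<eta> ^ length \<sigma> \<le> M \<sigma>" "M \<sigma> \<le> \<theta> ^ length \<sigma>" if "set \<sigma> \<subseteq> {1..N}" for \<sigma>
    using norm_bounds[OF that] by auto
  fix \<sigma> \<tau> assume \<sigma>: "set \<sigma> \<subseteq> {1..N}" and \<tau>: "set \<tau> \<subseteq> {1..N}"
  then have \<sigma>\<tau>: "set (\<sigma> @ \<tau>) \<subseteq> {1..N}" by simp
  have nonneg: "0 \<le> M \<sigma>" if "set \<sigma> \<subseteq> {1..N}" for \<sigma>
    using norm_bounds[OF that] \<eta>_gt_0 by (meson less_imp_le order_trans zero_less_power)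
  define x y where "x = \<phi> \<tau> 1" and "y = \<phi> \<tau> 0"
  have xy: "x \<in> {0..1}" "y \<in> {0..1}" using word_map_range[OF \<tau>] by (auto simp: x_def y_def)
  have \<tau>b: "M \<tau> \<le> K * \<bar>x - y\<bar>" "\<bar>x - y\<bar> \<le> M \<tau>"
    using inverse_lipschitz[OF \<tau>, of 1 0] lipschitz[OF \<tau>, of 1 0] by (auto simp: x_def y_def)
  define d where "d = \<bar>\<phi> \<sigma> x - \<phi> \<sigma> y\<bar>"
  have d: "M (\<sigma> @ \<tau>) \<le> K * d" "d \<le> M (\<sigma> @ \<tau>)" "M \<sigma> * \<bar>x - y\<bar> \<le> K * d" "d \<le> M \<sigma> * \<bar>x - y\<bar>"
    using inverse_lipschitz[OF \<sigma>\<tau>, of 1 0] lipschitz[OF \<sigma>\<tau>, of 1 0]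
      inverse_lipschitz[OF \<sigma> xy] lipschitz[OF \<sigma> xy]
    by (auto simp: x_def y_def d_def word_map_append)
  have "M \<sigma> * M \<tau> \<le> M \<sigma> * (K * \<bar>x - y\<bar>)" using \<tau>b(1) nonneg[OF \<sigma>] by (rule mult_left_mono)
  also have "\<dots> = K * (M \<sigma> * \<bar>x - y\<bar>)" by simp
  also have "\<dots> \<le> K * (K * d)" using d(3) K_ge_1 by (intro mult_left_mono) auto
  also have "\<dots> \<le> K * (K * M (\<sigma> @ \<tau>))" using d(2) K_ge_1 by (intro mult_left_mono) auto
  finally show "M \<sigma> * M \<tau> \<le> K\<^sup>2 * M (\<sigma> @ \<tau>)" by (simp add: power2_eq_square mult.assoc)
  have "M (\<sigma> @ \<tau>) \<le> K * (M \<sigma> * M \<tau>)"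
    using d(1,4) mult_left_mono[OF \<tau>b(2) nonneg[OF \<sigma>]] K_ge_1
    by (meson mult_left_mono order_trans zero_le_one)
  also have "\<dots> \<le> K\<^sup>2 * (M \<sigma> * M \<tau>)"
    using nonneg[OF \<sigma>] nonneg[OF \<tau>] K_ge_1
    by (intro mult_right_mono) (auto simp: power2_eq_square)
  finally show "M (\<sigma> @ \<tau>) \<le> K\<^sup>2 * (M \<sigma> * M \<tau>)" .
qed

lemma word_interval_compact: "set \<sigma> \<subseteq> {1..N} \<Longrightarrow> compact (I \<sigma>)"
  unfolding word_interval_def
  by (intro compact_continuous_image DERIV_continuous_on[OF word_map_has_derivative]) auto

lemma word_interval_subset: "set \<sigma> \<subseteq> {1..N} \<Longrightarrow> I \<sigma> \<subseteq> {0..1}"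
  using word_map_range by (auto simp: word_interval_def simp del: atLeastAtMost_iff)

lemma word_interval_append_subset:
  "set \<tau> \<subseteq> {1..N} \<Longrightarrow> I (\<sigma> @ \<tau>) \<subseteq> I \<sigma>"
  unfolding word_interval_append using word_interval_subset[of \<tau>]
  by (auto simp: word_interval_def[of f J \<sigma>])

lemma word_interval_dist_le:
  assumes "set \<sigma> \<subseteq> {1..N}" "x \<in> I \<sigma>" "y \<in> I \<sigma>"
  shows "\<bar>x - y\<bar> \<le> M \<sigma>"
proof -
  obtain u v where uv: "u \<in> {0..1}" "v \<in> {0..1}" "x = \<phi> \<sigma> u" "y = \<phi> \<sigma> v"
    using assms(2,3) by (auto simp: word_interval_def simp del: atLeastAtMost_iff)
  then have "\<bar>x - y\<bar> \<le> M \<sigma> * \<bar>u - v\<bar>" using lipschitz[OF assms(1)] by simp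
  also have "\<dots> \<le> M \<sigma> * 1"
    using uv(1,2) weight.weight_pos[OF assms(1)] by (intro mult_left_mono) auto
  finally show ?thesis by simp
qed

lemma word_interval_diameter:
  assumes "set \<sigma> \<subseteq> {1..N}"
  shows "diameter (I \<sigma>) \<le> M \<sigma>" "M \<sigma> \<le> K * diameter (I \<sigma>)"
proof -
  have ne: "I \<sigma> \<noteq> {}" by (simp add: word_interval_def)
  show "diameter (I \<sigma>) \<le> M \<sigma>"
    using word_interval_dist_le[OF assms] ne by (intro diameter_le) auto
  have "M \<sigma> \<le> K * \<bar>\<phi> \<sigma> 1 - \<phi> \<sigma> 0\<bar>" using inverse_lipschitz[OF assms, of 1 0] by simp
  moreover have "\<bar>\<phi> \<sigma> 1 - \<phi> \<sigma> 0\<bar> \<le> diameter (I \<sigma>)"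
    using diameter_bounded_bound[OF compact_imp_bounded[OF word_interval_compact[OF assms]]]
    by (auto simp: word_interval_def dist_real_def)
  ultimately show "M \<sigma> \<le> K * diameter (I \<sigma>)"
    using K_ge_1 by (meson mult_left_mono order_trans zero_le_one)
qed

lemma word_interval_disjoint:
  "length \<sigma> = length \<tau> \<Longrightarrow> set \<sigma> \<subseteq> {1..N} \<Longrightarrow> set \<tau> \<subseteq> {1..N} \<Longrightarrow> x \<in> I \<sigma> \<Longrightarrow> x \<in> I \<tau> \<Longrightarrow> \<sigma> = \<tau>"
proof (induction \<sigma> \<tau> arbitrary: x rule: list_induct2)
  case (Cons i \<sigma> j \<tau>)
  obtain u v where uv: "u \<in> {0..1}" "v \<in> {0..1}" "x = \<phi> (i # \<sigma>) u" "x = \<phi> (j # \<tau>) v"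
    using Cons.prems by (auto simp: word_interval_def simp del: atLeastAtMost_iff)
  have "x \<in> J i" "x \<in> J j"
    using word_map_Cons_range uv Cons.prems by metis+
  moreover have ij: "i \<in> {1..N}" "j \<in> {1..N}" using Cons.prems by auto
  ultimately have "i = j" using branch_gap[OF ij, of x x] \<delta>_pos by fastforce
  have "f x = \<phi> \<sigma> u" "f x = \<phi> \<tau> v"
    using uv branch_inverse(2)[OF ij(1) word_map_range[OF _ uv(1), of \<sigma>]]
      branch_inverse(2)[OF ij(2) word_map_range[OF _ uv(2), of \<tau>]] Cons.prems by auto
  then have "f x \<in> I \<sigma>" "f x \<in> I \<tau>"
    unfolding word_interval_def using uv(1,2) by (metis imageI)+
  with Cons.IH[of "f x"] Cons.prems \<open>i = j\<close> show ?case by simp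
qed simp

lemma weight_trunc_tendsto_0:
  assumes "\<tau> \<in> inf_words N"
  shows "(\<lambda>k. M (trunc k \<tau>)) \<longlonglongrightarrow> 0"
proof (rule tendsto_sandwich[where f = "\<lambda>_. 0" and h = "\<lambda>k. \<theta> ^ k"])
  show "(\<lambda>k. \<theta> ^ k) \<longlonglongrightarrow> 0"
    using weight.\<theta>_pos \<theta>_lt_1 by (intro LIMSEQ_realpow_zero) auto
  show "\<forall>\<^sub>F k in sequentially. 0 \<le> M (trunc k \<tau>)"
    using weight.weight_pos[OF set_trunc[OF assms]] by (simp add: less_imp_le)
  show "\<forall>\<^sub>F k in sequentially. M (trunc k \<tau>) \<le> \<theta> ^ k"
    using weight.weight_upper[OF set_trunc[OF assms]] by auto
qed simp

lemma weight_trunc_small: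
  assumes "\<tau> \<in> inf_words N" "0 < e"
  obtains k where "M (trunc k \<tau>) < e"
  using order_tendstoD(2)[OF weight_trunc_tendsto_0 assms(2)] assms(1)
  by (metis (mono_tags) eventually_happens trivial_limit_sequentially)

lemma coding_in_word_interval:
  assumes "\<tau> \<in> inf_words N"
  shows "coding f J \<tau> \<in> I (trunc k \<tau>)"
proof -
  note adm = set_trunc[OF assms]
  have "I (trunc (Suc n) \<tau>) \<subseteq> I (trunc n \<tau>)" for n
    unfolding trunc_Suc using assms by (intro word_interval_append_subset) (auto simp: inf_words_def)
  then have "I (trunc n \<tau>) \<subseteq> I (trunc m \<tau>)" if "m \<le> n" for m n
    using lift_Suc_antimono_le[of "\<lambda>n. I (trunc n \<tau>)"] that by blast
  moreover have "I (trunc n \<tau>) \<noteq> {}" for n by (simp add: word_interval_def)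
  ultimately have "(\<Inter>k. I (trunc k \<tau>)) \<noteq> {}"
    using word_interval_compact[OF adm] by (intro compact_nest) auto
  then obtain x where x: "x \<in> (\<Inter>k. I (trunc k \<tau>))" by blast
  have unique: "y = x" if y: "y \<in> (\<Inter>k. I (trunc k \<tau>))" for y
  proof (rule ccontr)
    assume "y \<noteq> x"
    then obtain k where "M (trunc k \<tau>) < \<bar>y - x\<bar>" using weight_trunc_small[OF assms] by (metis right_minus_eq zero_less_abs_iff)
    moreover have "\<bar>y - x\<bar> \<le> M (trunc k \<tau>)" using x y by (intro word_interval_dist_le adm) auto
    ultimately show False by simp
  qed
  have "coding f J \<tau> = x" unfolding coding_def using x unique by (intro the_equality)
  with x show ?thesis by blast
qed

lemma coding_eq_iff_prefix:
  assumes "\<tau> \<in> inf_words N" "set \<sigma> \<subseteq> {1..N}"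
  shows "coding f J \<tau> \<in> I \<sigma> \<longleftrightarrow> trunc (length \<sigma>) \<tau> = \<sigma>"
  using word_interval_disjoint[of "trunc (length \<sigma>) \<tau>" \<sigma> "coding f J \<tau>"]
    coding_in_word_interval[OF assms(1), of "length \<sigma>"] set_trunc[OF assms(1)] assms(2) by auto

text \<open>
  Where two words first differ, their points lie in the images under a common word map of two
  different branches, so the gap \<open>\<delta>\<close> survives in proportion to the weight of the common prefix.
\<close>

lemma coding_separated:
  assumes "\<tau> \<in> inf_words N" "\<tau>' \<in> inf_words N" "trunc k \<tau> = trunc k \<tau>'" "\<tau> k \<noteq> \<tau>' k"
  shows "\<delta> * M (trunc k \<tau>) \<le> K * \<bar>coding f J \<tau> - coding f J \<tau>'\<bar>"
proof -
  define \<sigma> where "\<sigma> = trunc k \<tau>"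
  have \<sigma>: "set \<sigma> \<subseteq> {1..N}" unfolding \<sigma>_def by (rule set_trunc[OF assms(1)])
  have letter: "I [j] \<subseteq> J j" if "j \<in> {1..N}" for j
    using branch_inverse(1)[OF that] by (auto simp: word_interval_def simp del: atLeastAtMost_iff)
  have l: "\<tau> k \<in> {1..N}" "\<tau>' k \<in> {1..N}" using assms by (auto simp: inf_words_def)
  have "coding f J \<tau> \<in> \<phi> \<sigma> ` I [\<tau> k]" "coding f J \<tau>' \<in> \<phi> \<sigma> ` I [\<tau>' k]"
    using coding_in_word_interval[OF assms(1), of "Suc k"] coding_in_word_interval[OF assms(2), of "Suc k"]
    by (simp_all add: trunc_Suc \<sigma>_def assms(3) word_interval_append)
  then obtain u v where uv: "u \<in> J (\<tau> k)" "v \<in> J (\<tau>' k)"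
    "coding f J \<tau> = \<phi> \<sigma> u" "coding f J \<tau>' = \<phi> \<sigma> v"
    using letter l by blast
  have "\<delta> * M \<sigma> \<le> M \<sigma> * \<bar>u - v\<bar>"
    using branch_gap[OF l assms(4) uv(1,2)] weight.weight_pos[OF \<sigma>] by (simp add: mult.commute)
  also have "\<dots> \<le> K * \<bar>\<phi> \<sigma> u - \<phi> \<sigma> v\<bar>"
    using inverse_lipschitz[OF \<sigma>] uv(1,2) branch_subset l by blast
  finally show ?thesis by (simp add: uv \<sigma>_def)
qed

text \<open>
  The coding map is the pointwise limit of functions of finitely many letters.
\<close>

lemma coding_measurable: "coding f J \<in> borel_measurable (restrict_space borel (inf_words N))"
proof (rule borel_measurable_LIMSEQ_real)
  show "(\<lambda>\<tau>. \<phi> (trunc k \<tau>) 0) \<in> borel_measurable (restrict_space borel (inf_words N))" for k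
    by (rule measurable_compose[OF measurable_restrict_space1[OF trunc_measurable]]) simp
  fix \<tau> assume "\<tau> \<in> space (restrict_space borel (inf_words N))"
  then have \<tau>: "\<tau> \<in> inf_words N" by (simp add: space_restrict_space)
  have "\<bar>\<phi> (trunc k \<tau>) 0 - coding f J \<tau>\<bar> \<le> M (trunc k \<tau>)" for k
    using coding_in_word_interval[OF \<tau>, of k]
    by (intro word_interval_dist_le set_trunc[OF \<tau>]) (auto simp: word_interval_def)
  then show "(\<lambda>k. \<phi> (trunc k \<tau>) 0) \<longlonglongrightarrow> coding f J \<tau>"
    by (intro LIM_zero_cancel[OF Lim_null_comparison[OF _ weight_trunc_tendsto_0[OF \<tau>]]]) auto
qed

section \<open>The Gibbs-like measure\<close>

text \<open>
  Every object of the theorem will be expressed through this exponent, which turns out to be the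
  quantization dimension of every order.
\<close>

definition h :: real where "h = cc_exponent f J N"

lemma cc_pressure_eq: "cc_pressure f J N t = weight.pressure t"
  by (simp add: cc_pressure_def weight.pressure_def weight.partition_sum_def)

lemma exponent: "0 < h" "weight.pressure h = 0"
proof -
  obtain s where s: "0 < s" "weight.pressure s = 0" by (rule weight.pressure_zero)
  have "h = s" unfolding h_def cc_exponent_def cc_pressure_eq
  proof (rule the_equality)
    show "t = s" if "0 < t \<and> weight.pressure t = 0" for t
      using that s(2) weight.pressure_inj[of t s] by simp
  qed (use s in simp)
  with s show "0 < h" "weight.pressure h = 0" by auto
qed

text \<open>
  This is the constant in the Gibbs inequality for cylinders.  Writing \<open>k = K powr h\<close>, three factors
  \<open>k\<^sup>2\<close> come from quasi-multiplicativity (one from splitting off the word, one from each of two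
  partition sums), and one factor \<open>k\<close> from replacing diameters by derivatives.
\<close>

definition C\<^sub>G :: real where "C\<^sub>G = K powr (7 * h)"

lemma C\<^sub>G_ge_1: "1 \<le> C\<^sub>G"
  using K_ge_1 exponent(1) by (simp add: C\<^sub>G_def ge_one_powr_ge_zero)

lemma diameter_powr_bounds:
  assumes "set \<sigma> \<subseteq> {1..N}"
  shows "diameter (I \<sigma>) powr h \<le> M \<sigma> powr h" "M \<sigma> powr h \<le> K powr h * diameter (I \<sigma>) powr h"
proof -
  have nonneg: "0 \<le> diameter (I \<sigma>)"
    by (intro diameter_ge_0 compact_imp_bounded word_interval_compact assms)
  show "diameter (I \<sigma>) powr h \<le> M \<sigma> powr h"
    using word_interval_diameter[OF assms] nonneg exponent(1) by (intro powr_mono2) auto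
  have "M \<sigma> powr h \<le> (K * diameter (I \<sigma>)) powr h"
    using word_interval_diameter[OF assms] weight.weight_pos[OF assms] exponent(1)
    by (intro powr_mono2) auto
  then show "M \<sigma> powr h \<le> K powr h * diameter (I \<sigma>) powr h" by (simp add: powr_mult)
qed

text \<open>
  Up to bounded factors, the numerator is \<open>M \<sigma> powr h\<close> times a partition sum and the denominator is a
  partition sum; at the exponent \<open>h\<close> both partition sums are bounded above and below.  The bounds do
  not depend on \<open>n\<close>, hence any Banach limit inherits them.
\<close>

lemma cyl_ratio_bounds:
  assumes "set \<sigma> \<subseteq> {1..N}"
  shows "M \<sigma> powr h / C\<^sub>G \<le> cyl_ratio f J N n \<sigma>" "cyl_ratio f J N n \<sigma> \<le> C\<^sub>G * M \<sigma> powr h"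
proof -
  define k where "k = K powr h"
  have k: "1 \<le> k" using K_ge_1 exponent(1) by (simp add: k_def ge_one_powr_ge_zero)
  have D: "(K\<^sup>2) powr \<bar>h\<bar> = k ^ 2" and CG: "C\<^sub>G = k ^ 7"
    using K_ge_1 exponent(1) powr_power[of K h 7]
    by (simp_all add: k_def C\<^sub>G_def power2_eq_square powr_mult mult.commute)
  define A where "A = (\<Sum>\<tau>\<in>words N n. diameter (I (\<sigma> @ \<tau>)) powr h)"
  define B where "B = (\<Sum>\<tau>\<in>words N (length \<sigma> + n). diameter (I \<tau>) powr h)"
  define A' where "A' = (\<Sum>\<tau>\<in>words N n. M (\<sigma> @ \<tau>) powr h)"
  let ?S = "weight.partition_sum h"
  have ratio: "cyl_ratio f J N n \<sigma> = A / B" by (simp add: cyl_ratio_def A_def B_def h_def)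
  have A: "A \<le> A'" "A' \<le> k * A"
    unfolding A_def A'_def sum_distrib_left k_def
    using assms by (intro sum_mono diameter_powr_bounds; simp add: words_def)+
  have B: "B \<le> ?S (length \<sigma> + n)" "?S (length \<sigma> + n) \<le> k * B"
    unfolding B_def weight.partition_sum_def sum_distrib_left k_def
    by (intro sum_mono diameter_powr_bounds; simp add: words_def)+
  have A': "A' \<le> k ^ 2 * (M \<sigma> powr h * ?S n)" "M \<sigma> powr h * ?S n \<le> k ^ 2 * A'"
    using weight.sum_extensions_bounds[OF assms, of h n] unfolding A'_def D by auto
  have S: "?S m \<le> k ^ 2" "1 \<le> k ^ 2 * ?S m" for m
    using weight.partition_sum_bounds_at_zero[OF exponent(2), of m] unfolding D by auto
  have w: "0 < M \<sigma> powr h" using weight.weight_pos[OF assms] by simp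
  have k0: "0 < k" "0 \<le> k ^ 2" using k by auto
  have B_pos: "0 < B"
  proof -
    have "0 < k * B" using B(2) weight.partition_sum_pos[of h "length \<sigma> + n"] by linarith
    then show ?thesis using k0(1) by (simp add: zero_less_mult_iff)
  qed
  have kB: "1 \<le> k ^ 3 * B"
  proof -
    have "1 \<le> k ^ 2 * (k * B)"
      using S(2) mult_left_mono[OF B(2) k0(2)] by (rule order_trans)
    then show ?thesis by (simp add: power3_eq_cube power2_eq_square mult.assoc)
  qed
  have "A \<le> k ^ 2 * (M \<sigma> powr h * k ^ 2)"
    using A(1) A'(1) mult_left_mono[OF mult_left_mono[OF S(1)[of n]], of "M \<sigma> powr h" "k ^ 2"] w k0
    by linarith
  also have "\<dots> \<le> k ^ 2 * (M \<sigma> powr h * k ^ 2) * (k ^ 3 * B)"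
    using mult_left_mono[OF kB, of "k ^ 2 * (M \<sigma> powr h * k ^ 2)"] w k0 by simp
  also have "\<dots> = C\<^sub>G * M \<sigma> powr h * B"
    unfolding CG by (simp add: eval_nat_numeral)
  finally show "cyl_ratio f J N n \<sigma> \<le> C\<^sub>G * M \<sigma> powr h"
    unfolding ratio using B_pos by (simp add: field_simps)
  have "M \<sigma> powr h * B \<le> M \<sigma> powr h * k ^ 2"
    using B(1) S(1)[of "length \<sigma> + n"] w by (intro mult_left_mono) auto
  also have "\<dots> \<le> M \<sigma> powr h * k ^ 2 * (k ^ 2 * ?S n)"
    using mult_left_mono[OF S(2)[of n], of "M \<sigma> powr h * k ^ 2"] w k0 by simp
  also have "\<dots> = k ^ 4 * (M \<sigma> powr h * ?S n)" by (simp add: eval_nat_numeral)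
  also have "\<dots> \<le> k ^ 4 * (k ^ 2 * (k * A))"
    using order_trans[OF A'(2) mult_left_mono[OF A(2) k0(2)]] k0 by (intro mult_left_mono) auto
  also have "\<dots> = C\<^sub>G * A" unfolding CG by (simp add: eval_nat_numeral)
  finally show "M \<sigma> powr h / C\<^sub>G \<le> cyl_ratio f J N n \<sigma>"
    unfolding ratio using B_pos C\<^sub>G_ge_1 by (simp add: field_simps)
qed

end

lemma banach_limit_bounds:
  assumes "banach_limit L" "\<And>n. a \<le> x n" "\<And>n. x n \<le> b"
  shows "a \<le> L x" "L x \<le> b"
proof -
  have "Bseq x"
  proof (rule BseqI')
    show "norm (x n) \<le> \<bar>a\<bar> + \<bar>b\<bar>" for n using assms(2,3)[of n] by simp
  qed
  then have L: "liminf (\<lambda>n. ereal (x n)) \<le> ereal (L x)" "ereal (L x) \<le> limsup (\<lambda>n. ereal (x n))"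
    using assms(1) unfolding banach_limit_def by blast+
  have "ereal a \<le> liminf (\<lambda>n. ereal (x n))" using assms(2) by (intro Liminf_bounded) auto
  from order_trans[OF this L(1)] show "a \<le> L x" by simp
  have "limsup (\<lambda>n. ereal (x n)) \<le> ereal b" using assms(3) by (intro Limsup_bounded) auto
  from order_trans[OF L(2) this] show "L x \<le> b" by simp
qed

locale cookie_cutter_gibbs = cookie_cutter_geometry +
  fixes L :: "(nat \<Rightarrow> real) \<Rightarrow> real" and \<gamma> :: "(nat \<Rightarrow> nat) measure" and \<mu> :: "real measure"
  assumes banach: "banach_limit L" and gibbs: "gibbs_coding_measure f J N L \<gamma>"
    and \<mu>_def: "\<mu> = distr \<gamma> borel (coding f J)"
begin

abbreviation E :: "real set" where "E \<equiv> cookie_cutter_set f J N"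

lemma sets_\<gamma>: "sets \<gamma> = sets (restrict_space borel (inf_words N))"
  using gibbs by (simp add: gibbs_coding_measure_def)

sublocale prob_\<gamma>: prob_space \<gamma>
  using gibbs by (simp add: gibbs_coding_measure_def)

lemma space_\<gamma>: "space \<gamma> = inf_words N"
  using sets_eq_imp_space_eq[OF sets_\<gamma>] by (simp add: space_restrict_space)

lemma coding_measurable_\<gamma>: "coding f J \<in> borel_measurable \<gamma>"
  using coding_measurable measurable_cong_sets[OF sets_\<gamma> refl] by blast

lemma cylinder_in_sets: "cylinder N \<sigma> \<in> sets \<gamma>"
proof -
  have "trunc (length \<sigma>) \<in> \<gamma> \<rightarrow>\<^sub>M count_space UNIV"
    using measurable_restrict_space1[OF trunc_measurable] measurable_cong_sets[OF sets_\<gamma> refl] by blast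
  from measurable_sets[OF this, of "{\<sigma>}"] show ?thesis
    by (simp add: space_\<gamma> cylinder_def vimage_def Int_def conj_commute)
qed

lemma measure_\<mu>: "A \<in> sets borel \<Longrightarrow> measure \<mu> A = measure \<gamma> {\<tau> \<in> inf_words N. coding f J \<tau> \<in> A}"
  unfolding \<mu>_def
  by (subst measure_distr[OF coding_measurable_\<gamma>])
    (simp_all add: space_\<gamma> vimage_def Int_def conj_commute)

lemma coding_preimage_in_sets: "A \<in> sets borel \<Longrightarrow> {\<tau> \<in> inf_words N. coding f J \<tau> \<in> A} \<in> sets \<gamma>"
  using measurable_sets[OF coding_measurable_\<gamma>, of A]
  by (simp add: space_\<gamma> vimage_def Int_def conj_commute)

lemma cylinder_measure_bounds:
  assumes "set \<sigma> \<subseteq> {1..N}"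
  shows "M \<sigma> powr h / C\<^sub>G \<le> measure \<gamma> (cylinder N \<sigma>)" "measure \<gamma> (cylinder N \<sigma>) \<le> C\<^sub>G * M \<sigma> powr h"
proof -
  have "measure \<gamma> (cylinder N \<sigma>) = L (\<lambda>n. cyl_ratio f J N (Suc n) \<sigma>)"
    using gibbs assms by (simp add: gibbs_coding_measure_def words_def)
  then show "M \<sigma> powr h / C\<^sub>G \<le> measure \<gamma> (cylinder N \<sigma>)" "measure \<gamma> (cylinder N \<sigma>) \<le> C\<^sub>G * M \<sigma> powr h"
    using banach_limit_bounds[OF banach, of "M \<sigma> powr h / C\<^sub>G" "\<lambda>n. cyl_ratio f J N (Suc n) \<sigma>" "C\<^sub>G * M \<sigma> powr h"]
      cyl_ratio_bounds[OF assms] by auto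
qed

text \<open>
  Intervals of distinct words of the same length are disjoint, so the coding map pulls an interval
  back to exactly one cylinder.
\<close>

lemma measure_word_interval:
  assumes "set \<sigma> \<subseteq> {1..N}"
  shows "measure \<mu> (I \<sigma>) = measure \<gamma> (cylinder N \<sigma>)"
proof -
  have "{\<tau> \<in> inf_words N. coding f J \<tau> \<in> I \<sigma>} = cylinder N \<sigma>"
    using coding_eq_iff_prefix[OF _ assms] by (auto simp: cylinder_def)
  then show ?thesis
    using measure_\<mu>[OF borel_compact[OF word_interval_compact[OF assms]]] by simp
qed

text \<open>
  By the Gibbs inequality \<open>measure \<mu> (I \<sigma>)\<close> may be replaced by \<open>M \<sigma> powr h\<close>, which adds \<open>h * q\<close> to
  the exponent \<open>t\<close>.
\<close>

lemma multifractal_pressure_eq: "multifractal_pressure f J N \<mu> q t = weight.pressure (h * q + t)"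
proof -
  have "(\<lambda>k. 1 / real k * ln (\<Sum>\<sigma>\<in>words N k. measure \<mu> (I \<sigma>) powr q * M \<sigma> powr t))
      \<longlonglongrightarrow> weight.pressure (h * q + t)"
  proof (rule growth_rate_cong[where v = "\<lambda>k \<sigma>. M \<sigma> powr (h * q + t)" and C = "C\<^sub>G powr \<bar>q\<bar>"])
    show "1 \<le> N" "0 < C\<^sub>G powr \<bar>q\<bar>" using two_le_N C\<^sub>G_ge_1 by auto
    fix k \<sigma> assume "\<sigma> \<in> words N k"
    then have \<sigma>: "set \<sigma> \<subseteq> {1..N}" by (simp add: words_def)
    define m where "m = measure \<mu> (I \<sigma>)"
    have m: "M \<sigma> powr h \<le> C\<^sub>G * m" "m \<le> C\<^sub>G * M \<sigma> powr h"
      using cylinder_measure_bounds[OF \<sigma>] C\<^sub>G_ge_1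
      by (auto simp: m_def measure_word_interval[OF \<sigma>] field_simps)
    have pos: "0 < M \<sigma>" "0 < M \<sigma> powr h" "0 < C\<^sub>G" using weight.weight_pos[OF \<sigma>] C\<^sub>G_ge_1 by auto
    then have "0 < C\<^sub>G * m" using m(1) by linarith
    then have "0 < m" using pos(3) by (simp add: zero_less_mult_iff)
    have split: "M \<sigma> powr (h * q + t) = (M \<sigma> powr h) powr q * M \<sigma> powr t"
      by (simp add: powr_add powr_powr)
    show "0 < M \<sigma> powr (h * q + t)" using pos by simp
    have "(M \<sigma> powr h) powr q \<le> C\<^sub>G powr \<bar>q\<bar> * m powr q" "m powr q \<le> C\<^sub>G powr \<bar>q\<bar> * (M \<sigma> powr h) powr q"
      using m pos \<open>0 < m\<close> by (auto intro!: powr_le_of_comparable)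
    then have "(M \<sigma> powr h) powr q * M \<sigma> powr t \<le> C\<^sub>G powr \<bar>q\<bar> * m powr q * M \<sigma> powr t"
      "m powr q * M \<sigma> powr t \<le> C\<^sub>G powr \<bar>q\<bar> * (M \<sigma> powr h) powr q * M \<sigma> powr t"
      by (auto intro!: mult_right_mono)
    then show "M \<sigma> powr (h * q + t) / C\<^sub>G powr \<bar>q\<bar> \<le> m powr q * M \<sigma> powr t"
      "m powr q * M \<sigma> powr t \<le> C\<^sub>G powr \<bar>q\<bar> * M \<sigma> powr (h * q + t)"
      unfolding split using pos by (auto simp: field_simps)
  next
    show "(\<lambda>k. 1 / real k * ln (\<Sum>\<sigma>\<in>words N k. M \<sigma> powr (h * q + t))) \<longlonglongrightarrow> weight.pressure (h * q + t)"
      using weight.pressure_limit unfolding weight.partition_sum_def .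
  qed
  then show ?thesis unfolding multifractal_pressure_def by (rule limI)
qed

lemma temperature_eq: "temperature f J N \<mu> q = h * (1 - q)"
proof -
  have "weight.pressure (h * q + t) = 0 \<longleftrightarrow> t = h * (1 - q)" for t
    using weight.pressure_inj[of "h * q + t" h] exponent(2) by (auto simp: algebra_simps)
  then show ?thesis unfolding temperature_def multifractal_pressure_eq by simp
qed

text \<open>
  Follow the word of one point of the ball as long as the gap at the current scale exceeds the
  diameter \<open>2 * \<rho>\<close>.  Up to that length all points of the ball share this prefix, so the ball is
  contained in one cylinder whose weight is at most a constant times \<open>\<rho>\<close>.
\<close>

lemma measure_cball_upper:
  assumes "0 < \<rho>"
  shows "measure \<mu> (cball x \<rho>) \<le> C\<^sub>G * (2 * K / \<delta>) powr h * \<rho> powr h"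
proof -
  define A where "A = {\<tau> \<in> inf_words N. coding f J \<tau> \<in> cball x \<rho>}"
  have \<mu>A: "measure \<mu> (cball x \<rho>) = measure \<gamma> A" unfolding A_def by (intro measure_\<mu>) simp
  show ?thesis
  proof (cases "A = {}")
    case True
    then show ?thesis using \<mu>A C\<^sub>G_ge_1 by simp
  next
    case False
    then obtain \<tau> where \<tau>: "\<tau> \<in> A" by blast
    then have \<tau>w: "\<tau> \<in> inf_words N" by (simp add: A_def)
    define k where "k = (LEAST k. \<delta> * M (trunc k \<tau>) \<le> K * (2 * \<rho>))"
    have "\<exists>k. \<delta> * M (trunc k \<tau>) \<le> K * (2 * \<rho>)"
    proof -
      have "0 < K * (2 * \<rho>) / \<delta>" using assms K_ge_1 \<delta>_pos by simp
      then obtain k where "M (trunc k \<tau>) < K * (2 * \<rho>) / \<delta>" using weight_trunc_small[OF \<tau>w] by blast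
      then show ?thesis using \<delta>_pos by (intro exI[of _ k]) (simp add: field_simps)
    qed
    then have k: "\<delta> * M (trunc k \<tau>) \<le> K * (2 * \<rho>)" unfolding k_def by (rule LeastI_ex)
    have before: "K * (2 * \<rho>) < \<delta> * M (trunc i \<tau>)" if "i < k" for i
      using not_less_Least[of i "\<lambda>k. \<delta> * M (trunc k \<tau>) \<le> K * (2 * \<rho>)"] that unfolding k_def by simp
    have "A \<subseteq> cylinder N (trunc k \<tau>)"
    proof
      fix \<tau>' assume \<tau>': "\<tau>' \<in> A"
      then have \<tau>'w: "\<tau>' \<in> inf_words N" by (simp add: A_def)
      have "\<bar>coding f J \<tau> - coding f J \<tau>'\<bar> \<le> 2 * \<rho>"
        using \<tau> \<tau>' by (auto simp: A_def dist_real_def)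
      then have close: "K * \<bar>coding f J \<tau> - coding f J \<tau>'\<bar> \<le> K * (2 * \<rho>)"
        using K_ge_1 by (intro mult_left_mono) auto
      have "trunc i \<tau> = trunc i \<tau>'" if "i \<le> k" for i
        using that
      proof (induction i)
        case (Suc i)
        then have eq: "trunc i \<tau> = trunc i \<tau>'" by simp
        have "\<tau> i = \<tau>' i"
          using coding_separated[OF \<tau>w \<tau>'w eq] before[of i] close Suc.prems by force
        with eq show ?case by (simp add: trunc_Suc)
      qed (simp add: trunc_def)
      then show "\<tau>' \<in> cylinder N (trunc k \<tau>)" using \<tau>'w by (simp add: cylinder_def)
    qed
    then have "measure \<gamma> A \<le> measure \<gamma> (cylinder N (trunc k \<tau>))"
      by (intro prob_\<gamma>.finite_measure_mono cylinder_in_sets)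
    also have "\<dots> \<le> C\<^sub>G * M (trunc k \<tau>) powr h" by (intro cylinder_measure_bounds set_trunc \<tau>w)
    also have "\<dots> \<le> C\<^sub>G * (2 * K / \<delta> * \<rho>) powr h"
      using k \<delta>_pos C\<^sub>G_ge_1 exponent(1) weight.weight_pos[OF set_trunc[OF \<tau>w]]
      by (intro mult_left_mono powr_mono2) (auto simp: field_simps less_imp_le)
    finally show ?thesis unfolding \<mu>A by (simp only: powr_mult mult.assoc)
  qed
qed

text \<open>
  The first interval around \<open>x\<close> of weight at most \<open>\<rho>\<close> is contained in the ball.  Its predecessor, if any, has
  weight greater than \<open>\<rho>\<close>, and one more letter shrinks the weight at most by the factor
  \<open>\<eta> / K\<^sup>2\<close>.
\<close>

lemma measure_cball_lower:
  assumes "x \<in> E" "0 < \<rho>" "\<rho> \<le> 1"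
  shows "\<rho> powr h \<le> C\<^sub>G * (K\<^sup>2 / \<eta>) powr h * measure \<mu> (cball x \<rho>)"
proof -
  obtain \<tau> where \<tau>: "\<tau> \<in> inf_words N" "x = coding f J \<tau>"
    using assms(1) by (auto simp: cookie_cutter_set_def)
  note adm = set_trunc[OF \<tau>(1)]
  define k where "k = (LEAST k. M (trunc k \<tau>) \<le> \<rho>)"
  have "\<exists>k. M (trunc k \<tau>) \<le> \<rho>" using weight_trunc_small[OF \<tau>(1) assms(2)] less_imp_le by metis
  then have k: "M (trunc k \<tau>) \<le> \<rho>" unfolding k_def by (rule LeastI_ex)
  have "\<eta> * \<rho> \<le> K\<^sup>2 * M (trunc k \<tau>)"
  proof (cases k)
    case 0
    have "1 \<le> M (trunc k \<tau>)" using weight.weight_lower[of "[]"] 0 by (simp add: trunc_def)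
    moreover have "\<eta> \<le> 1" using weight.\<eta>_le_\<theta> \<theta>_lt_1 by simp
    ultimately have "\<eta> * \<rho> \<le> 1 * 1" "1 * 1 \<le> K\<^sup>2 * M (trunc k \<tau>)"
      using assms(2,3) K_ge_1 by (intro mult_mono; simp)+
    then show ?thesis by simp
  next
    case (Suc i)
    have "\<rho> < M (trunc i \<tau>)" using not_less_Least[of i "\<lambda>k. M (trunc k \<tau>) \<le> \<rho>"] Suc unfolding k_def by simp
    moreover have l: "set [\<tau> i] \<subseteq> {1..N}" using \<tau>(1) by (simp add: inf_words_def)
    moreover have "\<eta> \<le> M [\<tau> i]" using weight.weight_lower[OF l] by simp
    ultimately have "\<rho> * \<eta> \<le> M (trunc i \<tau>) * M [\<tau> i]"
      using assms(2) \<eta>_gt_0 by (intro mult_mono) auto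
    also have "\<dots> \<le> K\<^sup>2 * M (trunc k \<tau>)"
      unfolding Suc trunc_Suc by (rule weight.weight_append_lower[OF adm l])
    finally show ?thesis by (simp add: mult.commute)
  qed
  then have "\<rho> \<le> K\<^sup>2 / \<eta> * M (trunc k \<tau>)" using \<eta>_gt_0 by (simp add: field_simps)
  then have "\<rho> powr h \<le> (K\<^sup>2 / \<eta>) powr h * M (trunc k \<tau>) powr h"
    using assms(2) exponent(1) by (subst powr_mult[symmetric]) (intro powr_mono2; simp)
  also have "\<dots> \<le> (K\<^sup>2 / \<eta>) powr h * (C\<^sub>G * measure \<gamma> (cylinder N (trunc k \<tau>)))"
    using cylinder_measure_bounds(1)[OF adm, of k] C\<^sub>G_ge_1
    by (intro mult_left_mono) (auto simp: field_simps)
  also have "\<dots> \<le> (K\<^sup>2 / \<eta>) powr h * (C\<^sub>G * measure \<mu> (cball x \<rho>))"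
  proof -
    have "cylinder N (trunc k \<tau>) \<subseteq> {\<tau>' \<in> inf_words N. coding f J \<tau>' \<in> cball x \<rho>}"
    proof
      fix \<tau>' assume "\<tau>' \<in> cylinder N (trunc k \<tau>)"
      then have \<tau>': "\<tau>' \<in> inf_words N" "trunc k \<tau>' = trunc k \<tau>" by (auto simp: cylinder_def)
      have "\<bar>coding f J \<tau> - coding f J \<tau>'\<bar> \<le> M (trunc k \<tau>)"
        using coding_in_word_interval[OF \<tau>(1), of k] coding_in_word_interval[OF \<tau>'(1), of k] \<tau>'(2)
        by (intro word_interval_dist_le adm) auto
      then show "\<tau>' \<in> {\<tau>' \<in> inf_words N. coding f J \<tau>' \<in> cball x \<rho>}"
        using k \<tau>' \<tau>(2) by (simp add: dist_real_def)
    qed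
    then have "measure \<gamma> (cylinder N (trunc k \<tau>)) \<le> measure \<mu> (cball x \<rho>)"
      unfolding measure_\<mu>[OF borel_closed[OF closed_cball]]
      by (intro prob_\<gamma>.finite_measure_mono coding_preimage_in_sets) auto
    then show ?thesis using C\<^sub>G_ge_1 by (intro mult_left_mono) auto
  qed
  finally show ?thesis by (simp add: ac_simps)
qed

definition C\<^sub>A :: real where
  "C\<^sub>A = max (C\<^sub>G * (2 * K / \<delta>) powr h) (C\<^sub>G * (K\<^sup>2 / \<eta>) powr h)"

sublocale \<mu>: ahlfors_regular \<mu> E h C\<^sub>A
proof -
  have prob: "prob_space \<mu>"
    unfolding \<mu>_def by (rule prob_\<gamma>.prob_space_distr[OF coding_measurable_\<gamma>])
  interpret prob_space \<mu> by (rule prob)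
  show "ahlfors_regular \<mu> E h C\<^sub>A"
  proof
    show "sets \<mu> = sets borel" by (simp add: \<mu>_def)
    have E_le: "E \<subseteq> {0..1}"
      using coding_in_word_interval[of _ 0] by (auto simp: cookie_cutter_set_def trunc_def word_interval_def)
    then show "bounded E" by (rule bounded_subset[rotated]) simp
    show "measure \<mu> A = 1" if "closed A" "E \<subseteq> A" for A
    proof -
      have "{\<tau> \<in> inf_words N. coding f J \<tau> \<in> A} = space \<gamma>"
        using that(2) by (auto simp: space_\<gamma> cookie_cutter_set_def)
      then show ?thesis using measure_\<mu>[OF borel_closed[OF that(1)]] prob_\<gamma>.prob_space by simp
    qed
    show "0 < h" by (rule exponent)
    have "0 < C\<^sub>G * (2 * K / \<delta>) powr h" using C\<^sub>G_ge_1 K_ge_1 \<delta>_pos by simp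
    then show "0 < C\<^sub>A" by (simp add: C\<^sub>A_def)
    show "measure \<mu> (cball x \<rho>) \<le> C\<^sub>A * \<rho> powr h" if "0 < \<rho>" for x \<rho>
      using measure_cball_upper[OF that, of x]
        mult_right_mono[of "C\<^sub>G * (2 * K / \<delta>) powr h" C\<^sub>A "\<rho> powr h"] by (simp add: C\<^sub>A_def)
    show "\<rho> powr h \<le> C\<^sub>A * measure \<mu> (cball x \<rho>)" if "x \<in> E" "0 < \<rho>" "\<rho> \<le> 1" for x \<rho>
      using measure_cball_lower[OF that]
        mult_right_mono[of "C\<^sub>G * (K\<^sup>2 / \<eta>) powr h" C\<^sub>A "measure \<mu> (cball x \<rho>)"] by (simp add: C\<^sub>A_def)
  qed
qed

end

section \<open>Quantization dimension of the Gibbs-like measure\<close>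

theorem theorem3p1:
  fixes f :: "real \<Rightarrow> real" and J :: "nat \<Rightarrow> real set" and N :: nat
    and L :: "(nat \<Rightarrow> real) \<Rightarrow> real" and \<mu> :: "real measure"
    and \<nu> :: "real \<Rightarrow> real" and r :: real
  assumes "cookie_cutter f J N"
    and "banach_limit L"
    and "gibbs_like_measure f J N L \<mu>"
    and "real_norm \<nu>"
    and "0 < r"
  defines "\<beta> \<equiv> temperature f J N \<mu>"
  shows "\<exists>\<kappa>>0.
           \<kappa> = \<beta> (\<kappa> / (r + \<kappa>)) / (1 - \<kappa> / (r + \<kappa>)) \<and>
           \<beta> (\<kappa> / (r + \<kappa>)) = r * (\<kappa> / (r + \<kappa>)) \<and>
           (\<forall>\<kappa>'>0. \<kappa>' = \<beta> (\<kappa>' / (r + \<kappa>')) / (1 - \<kappa>' / (r + \<kappa>')) \<longrightarrow> \<kappa>' = \<kappa>) \<and>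
           has_quantization_dimension \<nu> \<mu> r \<kappa> \<and>
           0 < lower_quantization_coefficient \<nu> \<mu> r \<kappa>"
proof -
  interpret cookie_cutter_map f J N by unfold_locales (rule assms(1))
  obtain K \<eta> \<theta> \<delta> where "cookie_cutter_geometry f J N K \<eta> \<theta> \<delta>" by (rule geometry_exists)
  then interpret G: cookie_cutter_geometry f J N K \<eta> \<theta> \<delta> .
  obtain \<gamma> where \<gamma>: "gibbs_coding_measure f J N L \<gamma>" "\<mu> = distr \<gamma> borel (coding f J)"
    using assms(3) unfolding gibbs_like_measure_def by blast
  interpret G: cookie_cutter_gibbs f J N K \<eta> \<theta> \<delta> L \<gamma> \<mu>
    by unfold_locales (use assms(2) \<gamma> in auto)
  have quotient: "\<beta> (\<kappa> / (r + \<kappa>)) / (1 - \<kappa> / (r + \<kappa>)) = G.h" if "0 < \<kappa>" for \<kappa>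
  proof -
    have "1 - \<kappa> / (r + \<kappa>) \<noteq> 0" using that assms(5) by (simp add: field_simps)
    then show ?thesis by (simp add: \<beta>_def G.temperature_eq)
  qed
  have "\<beta> (G.h / (r + G.h)) = r * (G.h / (r + G.h))"
    using G.exponent(1) assms(5) by (simp add: \<beta>_def G.temperature_eq field_simps)
  then show ?thesis
    using G.exponent(1) quotient[symmetric] quotient G.\<mu>.quantization_dimension[OF assms(4,5)]
      G.\<mu>.lower_quantization_coefficient_pos[OF assms(4,5)]
    by (intro exI[of _ G.h] conjI allI impI) metis+
qed

end
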